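(* There is a binary $3$-read $2$-deletion correcting code of length $n$ whose redundancy is at most $2\log n+O(1)$.
   Context: $\Sigma_2=\{0,1\}$; $z_{[a,b]}=z_a\cdots z_b$. A $3$-mer is an element of $\Sigma_2^3$. Two known $3$-mers $u,v\in\Sigma_2^3$ are fixed, and for $x\in\Sigma_2^n$ we put $\tilde x=uxv$, with coordinates indexed by $-2,\dots,n+3$, so that $\tilde x_{[-2,0]}=u$, $\tilde x_{[1,n]}=x$, $\tilde x_{[n+1,n+3]}=v$. The read vector is $\mathcal R_3(\tilde x)=(s_0,\dots,s_{n+3})$ with $s_i=\tilde x_{[i-2,i]}$. Deleting $3$-mers means passing to a (not necessarily contiguous) subvector; throughout it is assumed that $s_0$ and $s_{n+3}$ are not deleted. A nonempty code $\mathcal C\subseteq\Sigma_2^n$ is a $3$-read $2$-deletion correcting code if for any $x\in\mathcal C$ and any length-$(n+2)$ subvector $\mathcal R'$ of $\mathcal R_3(\tilde x)$, one can efficiently and uniquely decode $x$ from $\mathcal R'$ (uniqueness: $\mathcal R'$ cannot arise in this way from two different codewords). The redundancy of $\mathcal C$ is $\log(2^n/|\mathcal C|)$, with $\log$ to base $2$; $O(1)$ is as $n\to\infty$. *)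

theory Defs
  imports Complex_Main
begin

section \<open>Read vectors and deletion of reads\<close>

text \<open>Binary words are lists of type \<^typ>\<open>bool list\<close>; in particular a 3-mer is such a list of length 3.\<close>

definition words :: "nat \<Rightarrow> bool list set" where
  "words n = {x. length x = n}"

text \<open>
  For \<open>z = u @ x @ v\<close> with \<open>length u = length v = 3\<close> and \<open>length x = n\<close> the list position of the
  coordinate \<open>j \<in> {-2..n+3}\<close> is \<open>j + 2\<close>. Hence the read ending in coordinate \<open>i\<close> starts at list
  position \<open>i\<close>, and the read vector has the \<open>n + 4\<close> entries \<open>0, \<dots>, n + 3\<close>.
\<close>

definition read_vector :: "bool list \<Rightarrow> bool list list" where
  "read_vector z = map (\<lambda>i. take 3 (drop i z)) [0..<length z - 2]"

text \<open>\<open>D\<close> is the set of deleted positions; the first and the last entry are never deleted.\<close>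

definition deletions :: "nat \<Rightarrow> 'a list \<Rightarrow> 'a list set" where
  "deletions t s = {nths s (- D) | D. D \<subseteq> {0<..<length s - 1} \<and> card D = t}"

definition received :: "bool list \<Rightarrow> bool list \<Rightarrow> nat \<Rightarrow> bool list \<Rightarrow> bool list list set" where
  "received u v t x = deletions t (read_vector (u @ x @ v))"

definition redundancy :: "nat \<Rightarrow> bool list set \<Rightarrow> real" where
  "redundancy n C = log 2 (2 ^ n / real (card C))"


section \<open>Boolean circuits\<close>

text \<open>
  A circuit is a straight-line program: the wires \<open>0, \<dots>, m - 1\<close> carry the inputs, and the \<open>k\<close>-th
  gate drives the wire \<open>m + k\<close>. Its size is its number of gates.
\<close>

datatype 'w gate = ConstG bool | NotG 'w | AndG 'w 'w | OrG 'w 'w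

datatype circuit = Circuit (gates: "nat gate list") (outputs: "nat list")

definition circuit_wf :: "nat \<Rightarrow> circuit \<Rightarrow> bool" where
  "circuit_wf m c \<longleftrightarrow>
     (\<forall>k < length (gates c). \<forall>w \<in> set_gate (gates c ! k). w < m + k) \<and>
     (\<forall>w \<in> set (outputs c). w < m + length (gates c))"

fun gate_value :: "bool list \<Rightarrow> nat gate \<Rightarrow> bool" where
  "gate_value ws (ConstG b) = b"
| "gate_value ws (NotG i) = (\<not> ws ! i)"
| "gate_value ws (AndG i j) = (ws ! i \<and> ws ! j)"
| "gate_value ws (OrG i j) = (ws ! i \<or> ws ! j)"

fun run_gates :: "nat gate list \<Rightarrow> bool list \<Rightarrow> bool list" where
  "run_gates [] ws = ws"
| "run_gates (g # gs) ws = run_gates gs (ws @ [gate_value ws g])"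

definition run_circuit :: "circuit \<Rightarrow> bool list \<Rightarrow> bool list" where
  "run_circuit c inp = map (\<lambda>i. run_gates (gates c) inp ! i) (outputs c)"

definition circuit_size :: "circuit \<Rightarrow> nat" where
  "circuit_size c = length (gates c)"


section \<open>Correcting deleted reads\<close>

definition uniquely_decodable :: "bool list \<Rightarrow> bool list \<Rightarrow> nat \<Rightarrow> bool list set \<Rightarrow> bool" where
  "uniquely_decodable u v t C \<longleftrightarrow>
     (\<forall>x \<in> C. \<forall>y \<in> C. x \<noteq> y \<longrightarrow> received u v t x \<inter> received u v t y = {})"

text \<open>
  The input consists of the \<open>n + 4 - t\<close> received 3-mers, concatenated; nothing is required
  of the output on inputs that no codeword can produce.
\<close>

definition decodes :: "bool list \<Rightarrow> bool list \<Rightarrow> nat \<Rightarrow> nat \<Rightarrow> bool list set \<Rightarrow> circuit \<Rightarrow> bool" where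
  "decodes u v t n C c \<longleftrightarrow>
     circuit_wf (3 * (n + 4 - t)) c \<and>
     (\<forall>x \<in> C. \<forall>R \<in> received u v t x. run_circuit c (concat R) = x)"

text \<open>
  Efficiency is an asymptotic notion, so the property is one of a family with one code
  \<open>C n \<subseteq> words n\<close> for each length \<open>n \<ge> 1\<close>: decoding is efficient if it can be carried out by
  Boolean circuits of size polynomial in \<open>n\<close>. The circuit may depend on the code, and so on
  any parameters chosen for that length.
\<close>

definition efficiently_decodable ::
    "bool list \<Rightarrow> bool list \<Rightarrow> nat \<Rightarrow> (nat \<Rightarrow> bool list set) \<Rightarrow> bool" where
  "efficiently_decodable u v t C \<longleftrightarrow>
     (\<exists>a d :: nat. \<forall>n \<ge> 1. \<exists>c. decodes u v t n (C n) c \<and> circuit_size c \<le> a * n ^ d)"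

definition read_deletion_correcting ::
    "bool list \<Rightarrow> bool list \<Rightarrow> nat \<Rightarrow> (nat \<Rightarrow> bool list set) \<Rightarrow> bool" where
  "read_deletion_correcting u v t C \<longleftrightarrow>
     (\<forall>n \<ge> 1. C n \<noteq> {} \<and> C n \<subseteq> words n \<and> uniquely_decodable u v t (C n)) \<and>
     efficiently_decodable u v t C"

end

theory Submission
  imports Defs "HOL.Binomial_Plus" "HOL-Library.FuncSet" "HOL-Computational_Algebra.Primes"
begin

text \<open>
  Merge the received reads greedily, each with the largest possible overlap, into a word \<open>w\<close>. The
  transmitted word \<open>z = u @ x @ v\<close> is longer than \<open>w\<close> by 0, 1 or 2 bits, and it arises from \<open>w\<close> by
  lengthening at most two runs by one bit each, or by replacing some \<open>ab\<close> with \<open>a \<noteq> b\<close> by \<open>abab\<close>. The code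
  fixes the number of bit changes of \<open>z\<close> modulo 4 and, for a prime \<open>p\<close> between \<open>n + 6\<close> and a constant
  multiple of it, the sums over all positions of the run index and of its square modulo \<open>p\<close>. The
  first quantity separates the two kinds of expansion. Lengthening the runs \<open>i\<close> and \<open>j\<close> adds \<open>i + j\<close>
  and \<open>i\<^sup>2 + j\<^sup>2\<close> to the two sums, which determines \<open>{i, j}\<close>. An insertion of the second kind changes the
  first sum by a constant minus \<open>2 j\<close>, where \<open>j\<close> counts the positions up to the insertion that repeat
  their predecessor, and \<open>j\<close> determines the result. Some choice of the three residues is met by
  at least \<open>2 ^ n / (4 * p\<^sup>2)\<close> words, and \<open>log p = log n + O(1)\<close>.

  The decoder tries all pairs of deleted positions. For a given pair, every bit of \<open>x\<close> is a fixed
  input bit, and membership in the code is decided by an automaton with polynomially many states.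
\<close>


section \<open>Primes in linear ranges\<close>

text \<open>The reciprocals of \<open>m * (n choose m)\<close> form Leibniz' harmonic triangle, whose recurrence
  carries divisibility of the lcm from column \<open>m\<close> to column \<open>m + 1\<close>.\<close>

lemma mult_binomial_dvd_Lcm:
  fixes m n :: nat
  assumes "1 \<le> m" "m \<le> n"
  shows "m * (n choose m) dvd Lcm {1..n}"
proof -
  \<comment> \<open>Divisibility is carried as integrality of a real quotient, because the
    recurrence is a difference of unit fractions.\<close>
  have "\<exists>i::int. real (Lcm {1..n}) / real (m * (n choose m)) = of_int i"
    using assms
  proof (induction m arbitrary: n rule: nat_induct_at_least)
    case base
    then have "n dvd Lcm {1..n}" by (intro dvd_Lcm) auto
    then obtain k where "Lcm {1..n} = n * k" by blast
    moreover have "real n \<noteq> 0" using base by simp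
    ultimately have "real (Lcm {1..n}) / real (1 * (n choose 1)) = of_int (int k)"
      by (simp only: of_nat_mult) simp
    then show ?case by blast
  next
    case (Suc m)
    then obtain n' where n: "n = Suc n'" "m \<le> n'" by (cases n) auto
    obtain i j :: int where i: "real (Lcm {1..n}) / real (m * (n choose m)) = of_int i"
      and j: "real (Lcm {1..n'}) / real (m * (n' choose m)) = of_int j"
      using Suc.IH[of n] Suc.IH[of n'] n Suc.hyps by auto
    have "Lcm {1..n'} dvd Lcm {1..n}" using n by (intro Lcm_subset) auto
    then obtain k where k: "Lcm {1..n} = Lcm {1..n'} * k" by blast
    have pos: "real (n choose m) > 0" "real (n' choose m) > 0" "real (n choose Suc m) > 0" "real m > 0"
      using \<open>m \<le> n'\<close> Suc.prems Suc.hyps by (simp_all add: zero_less_binomial)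
    have "1 / real (Suc m * (n choose Suc m)) = 1 / real (m * (n' choose m)) - 1 / real (m * (n choose m))"
    proof -
      have "Suc m * (n choose Suc m) = Suc n' * (n' choose m)"
        using n Suc_times_binomial_eq[of n' m] by (simp add: mult.commute)
      then have a: "real (Suc m) * real (n choose Suc m) = real (Suc n') * real (n' choose m)"
        by (metis of_nat_mult)
      have "(Suc n' - m) * (Suc n' choose m) = Suc n' * (n' choose m)"
        using n(2) by (simp add: binomial_absorb_comp)
      then have b: "(real (Suc n') - real m) * real (n choose m) = real (Suc n') * real (n' choose m)"
        using n by (metis of_nat_diff of_nat_mult le_SucI)
      have ne: "real (Suc n') - real m \<noteq> 0" using n(2) by simp
      have c: "real (n choose m) = real (Suc n') * real (n' choose m) / (real (Suc n') - real m)"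
        using b ne by (simp add: field_simps)
      \<comment> \<open>With \<open>B = n' choose m\<close>, absorption makes both binomials of row
        \<open>n\<close> rational multiples of \<open>B\<close>, and the recurrence becomes this
        identity.\<close>
      have frac: "1 / (N * B) = 1 / (M * B) - 1 / (M * (N * B / (N - M)))"
        if "N > 0" "M > 0" "B > 0" "N - M \<noteq> 0" for N M B :: real
        using that by (simp add: divide_simps algebra_simps)
      show ?thesis
        unfolding of_nat_mult a c
        by (rule frac) (use pos ne in \<open>auto simp del: of_nat_Suc\<close>)
    qed
    then have "real (Lcm {1..n}) * (1 / real (Suc m * (n choose Suc m)))
        = real (Lcm {1..n}) * (1 / real (m * (n' choose m)) - 1 / real (m * (n choose m)))"
      by (simp only:)
    then have "real (Lcm {1..n}) / real (Suc m * (n choose Suc m))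
        = real (Lcm {1..n}) / real (m * (n' choose m)) - real (Lcm {1..n}) / real (m * (n choose m))"
      by (simp only: right_diff_distrib times_divide_eq_right mult_1_right)
    also have "real (Lcm {1..n}) / real (m * (n' choose m))
        = real k * (real (Lcm {1..n'}) / real (m * (n' choose m)))"
      unfolding k by simp
    finally have "real (Lcm {1..n}) / real (Suc m * (n choose Suc m)) = real k * of_int j - of_int i"
      unfolding i j .
    then show ?case
      by (intro exI[of _ "int k * j - i"]) simp
  qed
  then obtain i :: int where "real (Lcm {1..n}) / real (m * (n choose m)) = of_int i" by blast
  moreover have "m * (n choose m) > 0" using assms by simp
  ultimately have "real_of_int (int (Lcm {1..n})) = real_of_int (i * int (m * (n choose m)))"
    by (simp add: field_simps)
  then have "int (Lcm {1..n}) = i * int (m * (n choose m))" by linarith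
  then show ?thesis by (metis dvd_triv_right int_dvd_int_iff)
qed

text \<open>The multiplicity of \<open>p\<close> in an lcm is the maximum of the multiplicities, so
  some element attains it; the element 0 is divisible by everything.\<close>

lemma prime_power_dvd_Lcm:
  fixes p :: nat
  assumes "prime p" "finite A" "p ^ e dvd Lcm A" "e > 0"
  shows "\<exists>a\<in>A. p ^ e dvd a"
  using assms(2,3)
proof (induction A)
  case empty
  then show ?case using assms(1,4) by (simp add: prime_gt_1_nat)
next
  case (insert a A)
  show ?case
  proof (cases "Lcm A = 0 \<or> a = 0")
    case True
    then show ?thesis using insert by auto
  next
    case False
    have "\<not> is_unit p" using assms(1) not_prime_unit by blast
    then have pd: "p ^ e dvd x \<longleftrightarrow> e \<le> multiplicity p x" if "x \<noteq> 0" for x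
      using that by (intro power_dvd_iff_le_multiplicity)
    from False have "multiplicity p (lcm a (Lcm A)) = max (multiplicity p a) (multiplicity p (Lcm A))"
      using assms(1) by (intro multiplicity_lcm) auto
    then have "p ^ e dvd a \<or> p ^ e dvd Lcm A"
      using insert.prems False pd[of a] pd[of "Lcm A"] pd[of "lcm a (Lcm A)"] assms(2)
      by (auto simp: max_def Lcm_0_iff lcm_eq_0_iff split: if_splits)
    then show ?thesis using insert.IH by auto
  qed
qed

section \<open>Chebyshev-type bounds on products of primes and on lcms\<close>

lemma prod_primes_dvd:
  fixes n :: nat
  assumes "finite P" "\<And>p. p \<in> P \<Longrightarrow> prime p" "\<And>p. p \<in> P \<Longrightarrow> p dvd n"
  shows "\<Prod>P dvd n"
  using assms
proof (induction P)
  case (insert p P)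
  then have "coprime p (\<Prod>P)"
    by (intro prod_coprime_right) (metis insertCI primes_coprime)
  then show ?case
    using insert by (simp add: divides_mult)
qed simp

text \<open>Primes in \<open>(m, 2 m]\<close> divide the central binomial coefficient, which is at
  most \<open>4 ^ m\<close>, so doubling the range from \<open>m = 2 ^ k\<close> costs at most a
  factor \<open>4 ^ m\<close>.\<close>

lemma prod_primes_le_power: "\<Prod>{p::nat. prime p \<and> p \<le> 2 ^ k} \<le> 4 ^ (2 ^ k)"
proof (induction k)
  case 0
  have e: "{p::nat. prime p \<and> p \<le> 2 ^ 0} = {}" by (auto dest: prime_gt_1_nat)
  show ?case unfolding e by simp
next
  case (Suc k)
  define m :: nat where "m = 2 ^ k"
  define P where "P = {p::nat. prime p \<and> m < p \<and> p \<le> 2 * m}"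
  have fin: "finite P" unfolding P_def by simp
  have "\<Prod>P dvd (2 * m) choose m"
  proof -
    have "p dvd (2 * m) choose m" if "p \<in> P" for p
    proof -
      have p: "prime p" "m < p" "p \<le> 2 * m" using that by (auto simp: P_def)
      have "p dvd fact (2 * m)" using p by (simp add: prime_dvd_fact_iff)
      also have "fact (2 * m) = fact m * fact m * ((2 * m) choose m)"
        using binomial_fact_lemma[of m "2 * m"] by (simp add: mult_2)
      finally show ?thesis using p by (auto simp: prime_dvd_mult_iff prime_dvd_fact_iff)
    qed
    then show ?thesis using fin
      by (intro prod_primes_dvd) (auto simp: P_def)
  qed
  then have "\<Prod>P \<le> (2 * m) choose m" by (intro dvd_imp_le) auto
  also have "\<dots> \<le> 2 ^ (2 * m)" by (rule binomial_le_pow2)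
  also have "\<dots> = 4 ^ m" by (simp add: power_mult)
  finally have "\<Prod>P \<le> 4 ^ m" .
  moreover have "{p::nat. prime p \<and> p \<le> 2 ^ Suc k} = {p. prime p \<and> p \<le> 2 ^ k} \<union> P"
    by (auto simp: P_def m_def)
  then have "\<Prod>{p::nat. prime p \<and> p \<le> 2 ^ Suc k} = \<Prod>{p. prime p \<and> p \<le> 2 ^ k} * \<Prod>P"
    using fin by (simp add: P_def m_def prod.union_disjoint disjoint_iff)
  ultimately have "\<Prod>{p::nat. prime p \<and> p \<le> 2 ^ Suc k} \<le> 4 ^ m * 4 ^ m"
    using Suc.IH m_def by (simp add: mult_le_mono)
  then show ?case by (simp add: m_def power_add[symmetric] mult_2)
qed

text \<open>A prime power dividing the lcm is at most \<open>n\<close>. Hence a prime above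
  \<open>r\<close> occurs only to the first power, while the at most \<open>r\<close> smaller primes
  contribute at most a factor \<open>n\<close> each beyond the product of all primes up to
  \<open>2 ^ k\<close>.\<close>

lemma Lcm_le_if_prime_gap:
  fixes k n r :: nat
  assumes gap: "\<And>p. prime p \<Longrightarrow> 2 ^ k < p \<Longrightarrow> p \<le> n \<Longrightarrow> False"
    and n: "n = r\<^sup>2" "0 < r"
  shows "Lcm {1..n} \<le> n ^ r * 4 ^ (2 ^ k)"
proof -
  let ?L = "Lcm {1..n}" and ?P = "{p::nat. prime p \<and> p \<le> 2 ^ k}"
  define S where "S = {p \<in> ?P. p\<^sup>2 \<le> n}"
  have L0: "?L \<noteq> 0"
    by (metis Lcm_0_iff atLeastAtMost_iff finite_atLeastAtMost not_one_le_zero)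
  have small: "p ^ e \<le> n" if pe: "prime p" "p ^ e dvd ?L" "e > 0" for p e
  proof -
    obtain a where "a \<in> {1..n}" "p ^ e dvd a"
      using prime_power_dvd_Lcm[OF pe(1) finite_atLeastAtMost pe(2,3)] by blast
    then show ?thesis using dvd_imp_le[of "p ^ e" a] by auto
  qed
  have pf: "prime_factors ?L \<subseteq> ?P"
  proof
    fix p assume "p \<in> prime_factors ?L"
    then have p: "prime p" "p dvd ?L" by auto
    then have "p \<le> n" using small[of p 1] by simp
    then show "p \<in> ?P" using gap[of p] p by force
  qed
  have fin: "finite ?P" "finite S" unfolding S_def by auto
  have "S \<subseteq> {1..r}"
    using n by (auto simp: S_def prime_gt_0_nat Suc_le_eq intro: power2_le_imp_le)
  then have card: "card S \<le> r" using card_mono[of "{1..r}" S] by simp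
  have "?L = (\<Prod>p\<in>prime_factors ?L. p ^ multiplicity p ?L)"
    using L0 by (intro prime_factorization_nat) (simp only: neq0_conv)
  \<comment> \<open>For \<open>p\<close> in \<open>S\<close> the bound \<open>n\<close> is weakened
    to \<open>n * p\<close>, so that a full product of primes splits off.\<close>
  also have "\<dots> \<le> (\<Prod>p\<in>prime_factors ?L. (if p \<in> S then n else 1) * p)"
  proof (rule prod_mono, safe)
    fix p assume p: "p \<in> prime_factors ?L"
    let ?e = "multiplicity p ?L"
    have e: "p ^ ?e dvd ?L" "prime p" using p by (auto simp: multiplicity_dvd)
    have "p \<ge> 1" using e(2) by (simp add: prime_gt_0_nat Suc_le_eq)
    have e0: "?e > 0" using p by (simp add: prime_factors_multiplicity)
    show "p ^ ?e \<le> (if p \<in> S then n else 1) * p"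
    proof (cases "p \<in> S")
      case True
      have "p ^ ?e \<le> n * 1" using small[OF e(2,1) e0] by simp
      also have "\<dots> \<le> n * p" using \<open>p \<ge> 1\<close> by (intro mult_le_mono2)
      finally show ?thesis using True by simp
    next
      case False
      then have "\<not> p\<^sup>2 \<le> n" using pf p by (auto simp: S_def)
      then have "\<not> p\<^sup>2 dvd ?L" using small[OF e(2), of 2] by auto
      then have "?e < 2" using e(1) power_le_dvd[of p ?e ?L 2] by force
      then have "?e = 1" using e0 by simp
      then show ?thesis using False by simp
    qed
  qed
  also have "\<dots> \<le> (\<Prod>p\<in>?P. (if p \<in> S then n else 1) * p)"
    using n by (intro dvd_imp_le prod_dvd_prod_subset[OF fin(1) pf] prod_pos)
      (auto simp: prime_gt_0_nat)
  also have "\<dots> = (\<Prod>p\<in>?P. if p \<in> S then n else 1) * \<Prod>?P"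
    by (rule prod.distrib)
  also have "(\<Prod>p\<in>?P. if p \<in> S then n else 1) = (\<Prod>p\<in>?P \<inter> S. n)"
    by (rule prod.inter_restrict[symmetric]) (rule fin)
  also have "?P \<inter> S = S" by (auto simp: S_def)
  also have "(\<Prod>p\<in>S. n) = n ^ card S" by simp
  also have "n ^ card S * \<Prod>?P \<le> n ^ r * 4 ^ (2 ^ k)"
    by (rule mult_le_mono[OF power_increasing[OF card] prod_primes_le_power]) (use n in auto)
  finally show ?thesis .
qed

text \<open>Without such a prime the lcm of \<open>{1..n}\<close> would be too small for the central
  binomial coefficient, a divisor of it. Powers of 4 make \<open>n\<close> a square and the lower
  end a power of 2, as \<open>Lcm_le_if_prime_gap\<close> requires.\<close>

lemma prime_between_powers_of_4:
  assumes "5 \<le> l"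
  shows "\<exists>p::nat. prime p \<and> 4 ^ l < p \<and> p \<le> 4 ^ Suc l"
proof (rule ccontr)
  assume no: "\<not> ?thesis"
  define n :: nat where "n = 4 ^ Suc l"
  define m :: nat where "m = 2 * 4 ^ l"
  have nm: "n = 2 * m" "m > 0" by (simp_all add: n_def m_def)
  have pow: "(2::nat) ^ (2 * l) = 4 ^ l" by (simp add: power_mult)
  have sq: "n = (2 ^ Suc l)\<^sup>2"
    by (simp add: n_def power_mult[symmetric] mult.commute[of _ 2]) (simp add: power_mult)
  have "Lcm {1..n} \<le> n ^ (2 ^ Suc l) * 4 ^ (2 ^ (2 * l))"
    using no by (intro Lcm_le_if_prime_gap sq) (auto simp: pow n_def)
  moreover have "m * (n choose m) dvd Lcm {1..n}"
    using nm by (intro mult_binomial_dvd_Lcm) auto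
  then have "m * (n choose m) \<le> Lcm {1..n}"
    by (intro dvd_imp_le) (auto simp: Lcm_0_iff intro: Nat.gr0I)
  ultimately have le: "m * (n choose m) \<le> n ^ (2 ^ Suc l) * 4 ^ (4 ^ l)"
    by (simp add: pow)
  have "4 ^ m \<le> 2 * real m * real (n choose m)"
    using central_binomial_lower_bound[OF nm(2)] nm by (simp add: field_simps)
  then have "real (4 ^ m) \<le> real (2 * (m * (n choose m)))" by (simp add: mult.assoc)
  then have "4 ^ m \<le> 2 * (m * (n choose m))" by (simp only: of_nat_le_iff)
  also have "\<dots> \<le> n * (n ^ (2 ^ Suc l) * 4 ^ (4 ^ l))"
    using nm by (intro mult_le_mono[OF _ le]) auto
  also have "\<dots> = 4 ^ (Suc l * (2 ^ Suc l + 1) + 4 ^ l)"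
    by (simp only: n_def power_mult[symmetric] power_add power_one_right distrib_left mult_1_right mult.assoc)
      (simp only: mult_ac)
  \<comment> \<open>Exponents of 4 are compared. As \<open>m = 2 * 4 ^ l\<close>, a term
    \<open>4 ^ l\<close> cancels, and the rest on the right is of order \<open>l * 2 ^ l\<close>,
    which is below \<open>4 ^ l\<close> for \<open>l \<ge> 5\<close>.\<close>
  finally have "m \<le> Suc l * (2 ^ Suc l + 1) + 4 ^ l"
    by (rule power_le_imp_le_exp[rotated]) simp
  then have "4 ^ l \<le> Suc l * (2 ^ Suc l + 1)" by (simp add: m_def)
  moreover have "3 * Suc l < 2 ^ l" using assms by (induction l rule: nat_induct_at_least) auto
  then have "3 * Suc l * 2 ^ l < 2 ^ l * 2 ^ l" by simp
  moreover have "Suc l * (2 ^ Suc l + 1) \<le> 3 * Suc l * 2 ^ l"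
  proof -
    have "2 ^ Suc l + 1 \<le> 3 * (2::nat) ^ l" by simp
    then have "Suc l * (2 ^ Suc l + 1) \<le> Suc l * (3 * 2 ^ l)" by (rule mult_le_mono2)
    then show ?thesis by (simp only: mult_ac)
  qed
  moreover have "(2::nat) ^ l * 2 ^ l = 4 ^ l" by (simp add: power_mult_distrib[symmetric])
  ultimately show False by linarith
qed

lemma prime_in_linear_range:
  assumes "1 \<le> N"
  obtains p where "prime (p::nat)" "N < p" "p \<le> 4 ^ 6 * N"
proof -
  \<comment> \<open>The factor \<open>4 ^ 5\<close> is the price of exponent 5 at
    \<open>N = 1\<close> and covers the factor 4 of later roundings; the prime range costs one more
    4.\<close>
  have "\<exists>l\<ge>5. N \<le> 4 ^ l \<and> 4 ^ l \<le> 4 ^ 5 * N"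
    using assms
  proof (induction N rule: nat_induct_at_least)
    case base
    then show ?case by (intro exI[of _ 5]) simp
  next
    case (Suc N)
    then obtain l where l: "l \<ge> 5" "N \<le> 4 ^ l" "4 ^ l \<le> 4 ^ 5 * N" by blast
    show ?case
    proof (cases "Suc N \<le> 4 ^ l")
      case True
      then show ?thesis using l by (intro exI[of _ l]) auto
    next
      case False
      then have "N = 4 ^ l" using l by simp
      then show ?thesis using l by (intro exI[of _ "Suc l"]) auto
    qed
  qed
  then obtain l where l: "l \<ge> 5" "N \<le> 4 ^ l" "4 ^ l \<le> 4 ^ 5 * N" by blast
  obtain p :: nat where "prime p" "4 ^ l < p" "p \<le> 4 ^ Suc l"
    using prime_between_powers_of_4[OF l(1)] by blast
  then show thesis using l by (intro that[of p]) auto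
qed


section \<open>Run indices and insertions\<close>

text \<open>The first argument stands for a bit preceding the word: with \<open>False\<close> there, the runs of a word
  are numbered from 0 or from 1, according to its first bit.\<close>

fun flips :: "bool \<Rightarrow> bool list \<Rightarrow> nat" where
  "flips a [] = 0"
| "flips a (b # xs) = of_bool (a \<noteq> b) + flips b xs"

fun stays :: "bool \<Rightarrow> bool list \<Rightarrow> nat" where
  "stays a [] = 0"
| "stays a (b # xs) = of_bool (a = b) + stays b xs"

text \<open>The index \<open>k\<close> belongs to the run of the preceding bit \<open>a\<close>, so
  every bit is weighted by \<open>g\<close> of the index of its own run.\<close>

fun run_sum :: "(nat \<Rightarrow> nat) \<Rightarrow> bool \<Rightarrow> nat \<Rightarrow> bool list \<Rightarrow> nat" where
  "run_sum g a k [] = 0"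
| "run_sum g a k (b # xs) = g (k + of_bool (a \<noteq> b)) + run_sum g b (k + of_bool (a \<noteq> b)) xs"

lemma flips_append: "flips a (xs @ ys) = flips a xs + flips (last (a # xs)) ys"
  by (induction xs arbitrary: a) auto

lemma run_sum_append:
  "run_sum g a k (xs @ ys) = run_sum g a k xs + run_sum g (last (a # xs)) (k + flips a xs) ys"
  by (induction xs arbitrary: a k) (auto simp: add.assoc)

lemma flips_le_length: "flips a xs \<le> length xs"
  by (induction xs arbitrary: a) (auto simp: of_bool_def le_SucI)

lemma stays_add_flips: "stays a xs + flips a xs = length xs"
  by (induction xs arbitrary: a) (auto simp: of_bool_def)

lemma run_sum_shift: "run_sum (\<lambda>i. i) a (k + d) xs = run_sum (\<lambda>i. i) a k xs + d * length xs"
proof (induction xs arbitrary: a k)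
  case (Cons b xs)
  have "k + d + of_bool (a \<noteq> b) = (k + of_bool (a \<noteq> b)) + d" by simp
  then show ?case by (simp only: run_sum.simps Cons.IH) simp
qed simp

text \<open>Lengthening a run by one bit gives the same word wherever the bit is inserted, so the index of
  the run determines the result.\<close>

fun dup :: "nat \<Rightarrow> nat \<Rightarrow> bool \<Rightarrow> bool list \<Rightarrow> bool list" where
  "dup j k a [] = []"
| "dup j k a (b # xs) =
     (if k + of_bool (a \<noteq> b) = j then b # b # xs else b # dup j (k + of_bool (a \<noteq> b)) b xs)"

text \<open>Without flips, \<open>b # xs @ [c]\<close> is constant, so a bit may be taken from its
  front and put at its end.\<close>

lemma constant_shift: "flips b (xs @ [c]) = 0 \<Longrightarrow> b # xs @ c # ys = xs @ c # c # ys"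
  by (induction xs arbitrary: b) (auto split: if_splits)

text \<open>\<open>dup\<close> doubles the first bit it meets in run \<open>j\<close>, whereas
  \<open>c\<close> may stand further inside; \<open>constant_shift\<close> moves the new bit
  there.\<close>

lemma dup_append:
  "j = k + flips a (xs @ [c]) \<Longrightarrow> dup j k a (xs @ c # ys) = xs @ c # c # ys"
proof (induction xs arbitrary: a k)
  case (Cons b xs)
  show ?case
  proof (cases "flips b (xs @ [c]) = 0")
    case True
    then have "dup j k a ((b # xs) @ c # ys) = b # (b # xs @ c # ys)"
      using Cons.prems by simp
    also have "\<dots> = (b # xs) @ c # c # ys"
      by (simp only: constant_shift[OF True] append_Cons)
    finally show ?thesis .
  next
    case False
    then have "k + of_bool (a \<noteq> b) \<noteq> j" using Cons.prems by simp
    moreover have "j = (k + of_bool (a \<noteq> b)) + flips b (xs @ [c])"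
      using Cons.prems by simp
    ultimately show ?thesis using Cons.IH by simp
  qed
qed auto

text \<open>Doubling a bit leaves all run indices unchanged, so two doublings do not interfere.
  Hence it suffices to recover the indices as an unordered pair.\<close>

lemma dup_commute: "dup i k a (dup j k a w) = dup j k a (dup i k a w)"
proof (induction w arbitrary: a k)
  case (Cons b w)
  then show ?case by (cases "k + of_bool (a \<noteq> b) = i"; cases "k + of_bool (a \<noteq> b) = j") simp_all
qed simp

text \<open>Likewise, doubling a pair \<open>ab\<close> with \<open>a \<noteq> b\<close> to \<open>abab\<close> gives the same word for all pairs in one alternating
  stretch. Along such a stretch the number of \<open>stays\<close> is constant, so it can serve as the index.\<close>

fun alt_ins :: "nat \<Rightarrow> nat \<Rightarrow> bool \<Rightarrow> bool list \<Rightarrow> bool list" where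
  "alt_ins j k c [] = []"
| "alt_ins j k c (a # xs) =
     (if k + of_bool (c = a) = j then a # (\<not> a) # a # xs
      else a # alt_ins j (k + of_bool (c = a)) a xs)"

text \<open>Up to \<open>ys\<close>, both sides are the alternating word of the same length that
  starts with \<open>\<not> x\<close>.\<close>

lemma alternating_shift:
  "stays x (xs @ [a]) = 0 \<Longrightarrow> a \<noteq> b \<Longrightarrow> (\<not> x) # x # xs @ a # b # ys = xs @ a # b # a # b # ys"
proof (induction xs arbitrary: x)
  case (Cons y xs)
  then have "y = (\<not> x)" "stays y (xs @ [a]) = 0" by (auto split: if_splits)
  then show ?case using Cons.IH[of y] Cons.prems(2) by simp
qed (auto split: if_splits)

text \<open>\<open>alt_ins\<close> acts at the first bit it meets with index \<open>j\<close>, which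
  may precede \<open>a\<close> in the same alternating stretch; \<open>alternating_shift\<close>
  closes the gap.\<close>

lemma alt_ins_append:
  "a \<noteq> b \<Longrightarrow> j = k + stays c (xs @ [a]) \<Longrightarrow> alt_ins j k c (xs @ a # b # ys) = xs @ a # b # a # b # ys"
proof (induction xs arbitrary: c k)
  case (Cons x xs)
  show ?case
  proof (cases "stays x (xs @ [a]) = 0")
    case True
    then show ?thesis using Cons.prems alternating_shift[OF True] by simp
  next
    case False
    then have "k + of_bool (c = x) \<noteq> j" using Cons.prems by simp
    moreover have "j = (k + of_bool (c = x)) + stays x (xs @ [a])"
      using Cons.prems by simp
    ultimately show ?thesis using Cons.IH[OF Cons.prems(1)] by simp
  qed
qed auto

section \<open>Effect of one insertion on flips and sums\<close>

definition sticky :: "bool list \<Rightarrow> bool list \<Rightarrow> bool" where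
  "sticky w z \<longleftrightarrow> (\<exists>xs c ys. w = xs @ c # ys \<and> z = xs @ c # c # ys)"

definition alternation :: "bool list \<Rightarrow> bool list \<Rightarrow> bool" where
  "alternation w z \<longleftrightarrow>
     (\<exists>xs a b ys. a \<noteq> b \<and> w = xs @ a # b # ys \<and> z = xs @ a # b # a # b # ys)"

lemma sticky_length: "sticky w z \<Longrightarrow> length z = length w + 1"
  by (auto simp: sticky_def)

lemma alternation_length: "alternation w z \<Longrightarrow> length z = length w + 2"
  by (auto simp: alternation_def)

text \<open>The new bit lies in run \<open>j\<close> and no other bit changes its index, so each sum
  grows by \<open>g j\<close>. The bound on \<open>j\<close> later keeps it below
  \<open>p\<close>.\<close>

lemma sticky_dup:
  assumes "sticky w z"
  obtains j where "j \<le> length w" "z = dup j 0 False w" "flips False z = flips False w"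
    "\<And>g. run_sum g False 0 z = run_sum g False 0 w + g j"
proof -
  obtain xs c ys where w: "w = xs @ c # ys" and z: "z = xs @ c # c # ys"
    using assms by (auto simp: sticky_def)
  let ?j = "flips False (xs @ [c])"
  have "?j \<le> length w"
    using flips_le_length[of False "xs @ [c]"] w by simp
  moreover have "z = dup ?j 0 False w"
    unfolding w z by (rule dup_append[symmetric]) simp
  moreover have "flips False z = flips False w"
    unfolding w z by (simp add: flips_append)
  moreover have "run_sum g False 0 z = run_sum g False 0 w + g ?j" for g
    unfolding w z by (simp add: run_sum_append flips_append)
  ultimately show thesis by (rule that)
qed

text \<open>With \<open>?f\<close> flips up to \<open>a\<close>, the two new bits contribute
  \<open>2 * ?f + 3\<close> and every later bit moves up by two runs. Since \<open>?f\<close> is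
  \<open>length xs + 1 - ?j\<close>, only \<open>- 2 * ?j\<close> does not depend on
  \<open>w\<close> alone; it is moved to the left to avoid subtraction.\<close>

lemma alternation_alt_ins:
  assumes "alternation w z"
  obtains j where "j \<le> length w" "z = alt_ins j 0 False w" "flips False z = flips False w + 2"
    "run_sum (\<lambda>i. i) False 0 z + 2 * j = run_sum (\<lambda>i. i) False 0 w + 3 + 2 * length w"
proof -
  obtain xs a b ys where ab: "a \<noteq> b" and w: "w = xs @ a # b # ys" and z: "z = xs @ a # b # a # b # ys"
    using assms unfolding alternation_def by blast
  let ?j = "stays False (xs @ [a])" and ?f = "flips False (xs @ [a])"
  have len: "?j + ?f = length xs + 1"
    using stays_add_flips[of False "xs @ [a]"] by simp
  have "?j \<le> length w"
    using len w by simp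
  moreover have "z = alt_ins ?j 0 False w"
    unfolding w z by (rule alt_ins_append[symmetric]) (use ab in auto)
  moreover have "flips False z = flips False w + 2"
    unfolding w z using ab by (simp add: flips_append)
  moreover have "run_sum (\<lambda>i. i) False 0 z + 2 * ?j = run_sum (\<lambda>i. i) False 0 w + 3 + 2 * length w"
  proof -
    have zz: "z = (xs @ [a]) @ b # a # b # ys" and ww: "w = (xs @ [a]) @ b # ys"
      using w z by auto
    let ?S = "run_sum (\<lambda>i. i)"
    have "?S b (?f + 1 + 2) ys = ?S b (?f + 1) ys + 2 * length ys"
      by (rule run_sum_shift)
    moreover have "?S a ?f (b # a # b # ys) = 3 * ?f + 6 + ?S b (?f + 1 + 2) ys"
      "?S a ?f (b # ys) = ?f + 1 + ?S b (?f + 1) ys"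
      using ab by simp_all
    ultimately have "?S a ?f (b # a # b # ys) = ?S a ?f (b # ys) + 2 * ?f + 5 + 2 * length ys"
      by linarith
    then have "?S False 0 z = ?S False 0 w + 2 * ?f + 5 + 2 * length ys"
      unfolding zz ww run_sum_append[of "\<lambda>i. i" False 0 "xs @ [a]"]
      by (simp only: last.simps last_snoc append_is_Nil_conv list.distinct if_False add_0) simp
    then show ?thesis using len w by simp
  qed
  ultimately show thesis by (rule that)
qed


section \<open>Merging reads\<close>

text \<open>\<open>t\<close> is only an upper bound on the number of doublings; an alternation uses
  up two deletions.\<close>

inductive expands :: "nat \<Rightarrow> bool list \<Rightarrow> bool list \<Rightarrow> bool" where
  expands_refl: "expands t w w"
| expands_sticky: "expands t w y \<Longrightarrow> sticky y z \<Longrightarrow> expands (Suc t) w z"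
| expands_alternation: "alternation w z \<Longrightarrow> expands 2 w z"

lemma sticky_Cons: "sticky w z \<Longrightarrow> sticky (a # w) (a # z)"
  unfolding sticky_def by (metis append_Cons)

lemma alternation_Cons: "alternation w z \<Longrightarrow> alternation (a # w) (a # z)"
  unfolding alternation_def by (metis append_Cons)

lemma expands_Cons: "expands t w z \<Longrightarrow> expands t (a # w) (a # z)"
  by (induction rule: expands.induct) (auto intro: expands.intros sticky_Cons alternation_Cons)

lemma expands_0D: "expands 0 w z \<Longrightarrow> z = w"
  by (cases rule: expands.cases) auto


text \<open>Consecutive reads are overlapped as far as they agree, so a deletion that leaves no trace
  shortens the merged word.\<close>

fun glue :: "bool list \<Rightarrow> bool list \<Rightarrow> bool list" where
  "glue [a, b, c] (d # e # w) =
     (if b = d \<and> c = e then a # d # e # w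
      else if c = d then a # b # d # e # w
      else a # b # c # d # e # w)"
| "glue r w = r @ w"

fun merge :: "bool list list \<Rightarrow> bool list" where
  "merge [] = []"
| "merge [r] = r"
| "merge (r # rs) = glue r (merge rs)"

section \<open>Deletions as a recursion on the list of reads\<close>

inductive thins :: "nat \<Rightarrow> 'a list \<Rightarrow> 'a list \<Rightarrow> bool" where
  thins_last: "thins 0 [r] [r]"
| thins_keep: "thins t s R \<Longrightarrow> thins t (r # s) (r # R)"
| thins_drop: "thins t s R \<Longrightarrow> thins (Suc t) (r # s) R"

inductive_cases thins_ConsE: "thins t (r # s) R"

text \<open>Shifting the deleted positions by one passes to the tail; the last position is never in
  \<open>D\<close>, which matches the base case of \<open>thins\<close>.\<close>

lemma thins_nths: "D \<subseteq> {..<length s - 1} \<Longrightarrow> s \<noteq> [] \<Longrightarrow> thins (card D) s (nths s (- D))"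
proof (induction s arbitrary: D)
  case (Cons r s)
  show ?case
  proof (cases "s = []")
    case True
    then show ?thesis using Cons.prems by (auto intro: thins.intros)
  next
    case False
    define E where "E = {j. Suc j \<in> D}"
    have E: "E \<subseteq> {..<length s - 1}" using Cons.prems False by (auto simp: E_def)
    have IH: "thins (card E) s (nths s (- E))" using Cons.IH[OF E False] .
    have nths: "nths (r # s) (- D) = (if 0 \<in> D then [] else [r]) @ nths s (- E)"
    proof -
      have "{j. Suc j \<in> - D} = - E" by (auto simp: E_def)
      then show ?thesis by (simp add: nths_Cons)
    qed
    have finE: "finite E" using E finite_subset by blast
    have D: "D = (if 0 \<in> D then insert 0 (Suc ` E) else Suc ` E)"
    proof -
      have "x \<in> Suc ` E" if "x \<in> D" "x \<noteq> 0" for x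
        using that by (cases x) (auto simp: E_def)
      then show ?thesis by (auto simp: E_def)
    qed
    have "card D = (if 0 \<in> D then Suc (card E) else card E)"
      by (subst D) (simp add: finE card_image card_insert_if image_iff)
    then show ?thesis using IH nths by (auto intro: thins.intros)
  qed
qed simp

lemma thins_received:
  assumes "R \<in> deletions t (r # s)" "s \<noteq> []"
  obtains R' where "R = r # R'" "thins t s R'"
proof -
  obtain D where D: "R = nths (r # s) (- D)" "D \<subseteq> {0<..<length s}" "card D = t"
    using assms by (auto simp: deletions_def)
  define E where "E = {j. Suc j \<in> D}"
  have "{j. Suc j \<in> - D} = - E" by (auto simp: E_def)
  then have R: "R = r # nths s (- E)" using D by (auto simp: nths_Cons)
  have "D = Suc ` E"
  proof -
    have "x \<in> Suc ` E" if "x \<in> D" for x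
      using that D(2) by (cases x) (auto simp: E_def)
    then show ?thesis by (auto simp: E_def)
  qed
  then have "card E = t" using D(3) by (simp add: card_image)
  moreover have "E \<subseteq> {..<length s - 1}" using D(2) by (auto simp: E_def)
  ultimately have "thins t s (nths s (- E))" using thins_nths assms(2) by blast
  then show thesis using R that by blast
qed

lemma read_vector_rec:
  "read_vector (a # b # c # z) =
     [a, b, c] # (if z = [] then [] else read_vector (b # c # z))"
proof (cases z)
  case (Cons d z')
  have "[0..<Suc n] = 0 # map Suc [0..<n]" for n
    by (simp only: map_Suc_upt upt_conv_Cons zero_less_Suc)
  then show ?thesis using Cons by (simp add: read_vector_def del: upt_Suc)
qed (simp add: read_vector_def)

text \<open>The form of \<open>read_vector\<close> that recurses along the word, as the proof about
  merging does.\<close>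

fun reads :: "bool list \<Rightarrow> bool list list" where
  "reads (a # b # c # z) = [a, b, c] # reads (b # c # z)"
| "reads z = []"

lemma reads_eq_Nil_iff: "reads (a # b # z) = [] \<longleftrightarrow> z = []"
  by (cases z) auto

lemma read_vector_eq_reads: "3 \<le> length z \<Longrightarrow> read_vector z = reads z"
proof (induction z rule: reads.induct)
  case (1 a b c z)
  then show ?case by (cases z) (auto simp: read_vector_rec)
qed auto

lemma glue_prefix: "\<exists>v. glue [a, b, c] w = a # b # c # v"
  by (induction "[a, b, c]" w rule: glue.induct) auto

text \<open>Merging never alters the first read, so the bits compared when the next read is glued on
  are known.\<close>

lemma merge_prefix: "\<exists>w. merge ([a, b, c] # R) = a # b # c # w"
  using glue_prefix by (cases R) auto

text \<open>\<open>t \<le> 1\<close> excludes \<open>expands_alternation\<close>, whose cost is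
  fixed at 2.\<close>

lemma expands_SucI: "expands t w z \<Longrightarrow> t \<le> 1 \<Longrightarrow> expands (Suc t) w z"
  by (induction rule: expands.induct) (auto intro: expands.intros)

lemma expands_double_second:
  "expands t (c # w) (c # z) \<Longrightarrow> expands (Suc t) (a # c # w) (a # c # c # z)"
  by (rule expands_sticky[OF expands_Cons]) (auto simp: sticky_def intro: exI[of _ "[a]"])

text \<open>The situation at each stage of merging: the read at the front survives, so the word and
  the merged word start alike.\<close>

inductive first_kept :: "nat \<Rightarrow> bool list \<Rightarrow> bool list list \<Rightarrow> bool" where
  first_kept_single: "first_kept 0 [a, b, c] [[a, b, c]]"
| first_kept_Cons: "thins t (reads (b # c # z)) R \<Longrightarrow> first_kept t (a # b # c # z) ([a, b, c] # R)"

lemma thins_reads_cases: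
  assumes "thins t (reads z) R"
  obtains "first_kept t z R" | t' a z' where "t = Suc t'" "z = a # z'" "thins t' (reads z') R"
proof (cases z rule: reads.cases)
  case (1 a b c z')
  then have "thins t ([a, b, c] # reads (b # c # z')) R" using assms by simp
  then consider (last) "t = 0" "reads (b # c # z') = []" "R = [[a, b, c]]"
    | (keep) R' where "R = [a, b, c] # R'" "thins t (reads (b # c # z')) R'"
    | (drop) t' where "t = Suc t'" "thins t' (reads (b # c # z')) R"
    by (rule thins_ConsE)
  then show thesis
  proof cases
    case last
    then have "z' = []" by (simp add: reads_eq_Nil_iff)
    then show thesis using last 1 that(1) by (auto intro: first_kept.intros)
  next
    case keep
    then show thesis using 1 that(1) by (auto intro: first_kept.intros)
  next
    case drop
    then show thesis using 1 that(2) by blast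
  qed
qed (use assms in \<open>auto elim: thins.cases\<close>)

lemma first_kept_merge_prefix:
  assumes "first_kept t z R"
  obtains a b c z' R' w where "z = a # b # c # z'" "R = [a, b, c] # R'" "merge R = a # b # c # w"
  using assms merge_prefix by (cases rule: first_kept.cases) metis+

text \<open>Between neighbouring survivors lie 0, 1 or 2 deleted reads, and the true overlap is 2, 1
  or 0. The greedy overlap is at least the true one, and any excess forces equalities among the bits
  that make the loss a doubling or an alternation.\<close>

lemma expands_merge:
  "first_kept t z R \<Longrightarrow> t \<le> 2 \<Longrightarrow> expands t (merge R) z"
proof (induction "length z" arbitrary: t z R rule: less_induct)
  case less
  from less.prems(1) show ?case
  proof (cases rule: first_kept.cases)
    case (first_kept_single a b c)
    then show ?thesis by (simp add: expands_refl)
  next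
    case (first_kept_Cons b c z1 R1 a)
    have IH: "expands t' (merge R1) y" if "first_kept t' y R1" "length y < length z" "t' \<le> t" for t' y
      using less.hyps[of y t' R1] that less.prems(2) by simp
    from \<open>thins t (reads (b # c # z1)) R1\<close> show ?thesis
    proof (cases rule: thins_reads_cases)
      case 1
      obtain d R2 w where w: "R1 = [b, c, d] # R2" "merge R1 = b # c # d # w"
        using first_kept_merge_prefix[OF 1] by (metis list.inject)
      then have "merge R = a # merge R1" using first_kept_Cons by simp
      then show ?thesis using IH[OF 1] first_kept_Cons by (simp add: expands_Cons)
    next
      case (2 t1 b' y)
      then have t: "t = Suc t1" "t1 \<le> 1" and y: "y = c # z1" and R1: "thins t1 (reads (c # z1)) R1"
        using less.prems(2) by auto
      from R1 show ?thesis
      proof (cases rule: thins_reads_cases)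
        case 1
        obtain d e z2 R2 w where w: "z1 = d # e # z2" "R1 = [c, d, e] # R2" "merge R1 = c # d # e # w"
          using first_kept_merge_prefix[OF 1] by (metis list.inject)
        have ex: "expands t1 (c # d # e # w) (c # z1)"
          using IH[OF 1] w t first_kept_Cons by simp
        show ?thesis
        \<comment> \<open>The reads \<open>[a, b, c]\<close> and \<open>[c, d, e]\<close> truly
          share only \<open>c\<close>; the greedy overlap is two exactly in this case, and then one
          copy of \<open>c\<close> is lost.\<close>
        proof (cases "b = c \<and> c = d")
          case True
          then have "merge R = a # c # d # e # w" using w first_kept_Cons by simp
          then show ?thesis
            using True expands_double_second[OF ex, of a] t first_kept_Cons by simp
        next
          case False
          then have "merge R = a # b # c # d # e # w" using w first_kept_Cons by auto
          then show ?thesis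
            using expands_SucI[OF ex] t first_kept_Cons by (simp add: expands_Cons)
        qed
      next
        case (2 t2 c' y)
        then have t2: "t2 = 0" and t: "t = 2" and R1: "thins 0 (reads z1) R1"
          using t by auto
        from R1 show ?thesis
        proof (cases rule: thins_reads_cases)
          case 1
          obtain d e f z2 R2 w where w: "z1 = d # e # f # z2" "R1 = [d, e, f] # R2" "merge R1 = d # e # f # w"
            using first_kept_merge_prefix[OF 1] by metis
          \<comment> \<open>Both deletions are spent, so the rest of the word is recovered
            exactly.\<close>
          have "expands 0 (merge R1) z1" using IH[OF 1] first_kept_Cons by simp
          then have z1: "z1 = merge R1" by (rule expands_0D)
          have z: "z = a # b # c # d # e # f # w" using z1 w first_kept_Cons by simp
          \<comment> \<open>The true overlap is empty. A greedy overlap of two loses two bits, from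
            one run if \<open>b = c\<close> and from an alternating stretch otherwise; an overlap of
            one loses one bit.\<close>
          consider "b = d" "c = e" "b = c" | "b = d" "c = e" "b \<noteq> c"
            | "\<not> (b = d \<and> c = e)" "c = d" | "\<not> (b = d \<and> c = e)" "c \<noteq> d" by blast
          then show ?thesis
          proof cases
            case 1
            then have "merge R = a # c # c # f # w" using w first_kept_Cons by simp
            moreover have "expands 2 (a # c # c # f # w) (a # c # c # c # c # f # w)"
            proof -
              have "expands (Suc 0) (c # c # f # w) (c # c # c # f # w)"
                by (intro expands_double_second expands_refl)
              from expands_double_second[OF this, of a] show ?thesis by (simp add: numeral_2_eq_2)
            qed
            ultimately show ?thesis using 1 z t by simp
          next
            case 2
            then have "merge R = a # b # c # f # w" using w first_kept_Cons by simp
            moreover have "alternation (a # b # c # f # w) z"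
              using 2 z unfolding alternation_def by (intro exI[of _ "[a]"] exI[of _ b] exI[of _ c] exI[of _ "f # w"]) auto
            ultimately show ?thesis using t by (auto intro: expands_alternation)
          next
            case 3
            then have "merge R = a # b # c # e # f # w" using w first_kept_Cons by auto
            moreover have "expands (Suc 1) (a # b # c # e # f # w) (a # b # c # c # e # f # w)"
              by (intro expands_Cons expands_double_second expands_refl)
            ultimately show ?thesis using 3 z t by (simp add: numeral_2_eq_2)
          next
            case 4
            then have "merge R = z" using w first_kept_Cons z by auto
            then show ?thesis by (simp add: expands_refl)
          qed
        next
          case (2 t' a z')
          then show ?thesis by simp
        qed
      qed
    qed
  qed
qed

lemma received_expands:
  assumes "length u = 3" "length v = 3" "R \<in> received u v 2 x"
  shows "expands 2 (merge R) (u @ x @ v)"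
proof -
  obtain a b c where u: "u = [a, b, c]" using assms(1) by (auto simp: numeral_3_eq_3 length_Suc_conv)
  let ?s = "reads (b # c # x @ v)"
  have "?s \<noteq> []" using assms(2) by (cases x; cases v) auto
  moreover have "read_vector (u @ x @ v) = [a, b, c] # ?s"
    using assms(2) u by (simp add: read_vector_eq_reads)
  ultimately obtain R' where "R = [a, b, c] # R'" "thins 2 ?s R'"
    using assms(3) thins_received[of R 2 "[a, b, c]" ?s] by (auto simp: received_def)
  then have "first_kept 2 (u @ x @ v) R" using u by (auto intro: first_kept_Cons)
  then show ?thesis by (rule expands_merge) simp
qed


section \<open>The code\<close>

lemma int_dvd_diff_if_mod_eq:
  fixes a b c p :: nat
  assumes "(c + a) mod p = (c + b) mod p"
  shows "int p dvd int a - int b"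
proof -
  have "int (c + a) mod int p = int (c + b) mod int p"
    using assms by (metis of_nat_mod)
  then have "int p dvd int (c + a) - int (c + b)" by (simp add: mod_eq_dvd_iff)
  then show ?thesis by simp
qed

lemma eq_if_int_dvd_diff:
  fixes a b p :: nat
  assumes "int p dvd int a - int b" "a < p" "b < p"
  shows "a = b"
proof -
  have "\<bar>int a - int b\<bar> < int p" using assms(2,3) by linarith
  then show ?thesis using assms(1) zdvd_imp_le[of "int p" "\<bar>int a - int b\<bar>"] by auto
qed

lemma pair_eq_if_power_sums_eq:
  fixes i j i' j' p :: nat
  assumes p: "prime p" "2 < p" and lt: "i < p" "j < p" "i' < p" "j' < p"
    and sum: "int p dvd int (i + j) - int (i' + j')"
    and sq: "int p dvd int (i\<^sup>2 + j\<^sup>2) - int (i'\<^sup>2 + j'\<^sup>2)"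
  shows "i = i' \<and> j = j' \<or> i = j' \<and> j = i'"
proof -
  \<comment> \<open>Modulo \<open>p\<close>, equal power sums make \<open>i\<close> a root of
    \<open>(X - i') * (X - j')\<close>; the factor 2 cancels because \<open>p\<close> is
    odd.\<close>
  have "2 * (int i - int i') * (int i - int j')
      = (int (i\<^sup>2 + j\<^sup>2) - int (i'\<^sup>2 + j'\<^sup>2))
        - (int (i + j) - int (i' + j')) * (int j + int i' + int j' - int i)"
    by (simp add: power2_eq_square algebra_simps)
  then have "int p dvd 2 * (int i - int i') * (int i - int j')"
    using sum sq by (metis dvd_diff dvd_mult2)
  moreover have "prime (int p)" using p by simp
  moreover have "\<not> int p dvd 2" using p(2) zdvd_imp_le[of "int p" 2] by auto
  ultimately consider "int p dvd int i - int i'" | "int p dvd int i - int j'"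
    using prime_dvd_multD by blast
  then show ?thesis
  proof cases
    case 1
    then have "i = i'" using eq_if_int_dvd_diff lt by blast
    moreover have "j = j'" using sum lt calculation by (intro eq_if_int_dvd_diff[of p]) simp_all
    ultimately show ?thesis by simp
  next
    case 2
    then have "i = j'" using eq_if_int_dvd_diff lt by blast
    moreover have "j = i'" using sum lt calculation by (intro eq_if_int_dvd_diff[of p]) simp_all
    ultimately show ?thesis by simp
  qed
qed

definition signature :: "nat \<Rightarrow> bool list \<Rightarrow> nat \<times> nat \<times> nat" where
  "signature p z =
     (flips False z mod 4, run_sum (\<lambda>i. i) False 0 z mod p, run_sum (\<lambda>i. i\<^sup>2) False 0 z mod p)"

lemma expands_2_cases:
  assumes "expands 2 w z"
  obtains "z = w" | "sticky w z" | y where "sticky w y" "sticky y z" | "alternation w z"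
proof -
  have 1: "y = w \<or> sticky w y" if "expands 1 w y" for y
    using that by (cases rule: expands.cases) (auto dest: expands_0D)
  show thesis
    using assms by (cases rule: expands.cases) (use 1 that in \<open>auto simp: numeral_2_eq_2\<close>)
qed

text \<open>For one doubling the sum of run indices decides: it yields \<open>j\<close> modulo
  \<open>p\<close>, and \<open>j \<le> length w < p\<close>.\<close>

lemma signature_sticky_unique:
  assumes p: "length w < p" and "sticky w z" "sticky w z'" "signature p z = signature p z'"
  shows "z = z'"
proof -
  obtain j where j: "j \<le> length w" "z = dup j 0 False w"
    and js: "\<And>g. run_sum g False 0 z = run_sum g False 0 w + g j"
    using sticky_dup[OF assms(2)] by metis
  obtain j' where j': "j' \<le> length w" "z' = dup j' 0 False w"
    and js': "\<And>g. run_sum g False 0 z' = run_sum g False 0 w + g j'"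
    using sticky_dup[OF assms(3)] by metis
  have "(run_sum (\<lambda>i. i) False 0 w + j) mod p = (run_sum (\<lambda>i. i) False 0 w + j') mod p"
    using assms(4) js[of "\<lambda>i. i"] js'[of "\<lambda>i. i"] by (simp add: signature_def)
  then have "j = j'"
    using int_dvd_diff_if_mod_eq eq_if_int_dvd_diff j(1) j'(1) p by (meson le_less_trans)
  then show ?thesis using j j' by simp
qed

lemma two_sticky_dup:
  assumes "sticky w y" "sticky y z"
  obtains i j where "i \<le> length w + 1" "j \<le> length w + 1" "z = dup j 0 False (dup i 0 False w)"
    "flips False z = flips False w" "\<And>g. run_sum g False 0 z = run_sum g False 0 w + (g i + g j)"
proof -
  obtain i where i: "i \<le> length w" "y = dup i 0 False w" "flips False y = flips False w"
    and si: "\<And>g. run_sum g False 0 y = run_sum g False 0 w + g i"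
    using sticky_dup[OF assms(1)] by metis
  obtain j where j: "j \<le> length y" "z = dup j 0 False y" "flips False z = flips False y"
    and sj: "\<And>g. run_sum g False 0 z = run_sum g False 0 y + g j"
    using sticky_dup[OF assms(2)] by metis
  show thesis
    using that[of i j] i j si sj sticky_length[OF assms(1)] by simp
qed

text \<open>The two sums yield both power sums of the pair of run indices, hence the pair up to
  order, and \<open>dup_commute\<close> makes the order irrelevant.\<close>

lemma signature_two_sticky_unique:
  assumes p: "prime p" "2 < p" "length w + 1 < p"
    and z: "sticky w y" "sticky y z" and z': "sticky w y'" "sticky y' z'"
    and eq: "signature p z = signature p z'"
  shows "z = z'"
proof -
  obtain i j where ij: "i \<le> length w + 1" "j \<le> length w + 1"
    and dup: "z = dup j 0 False (dup i 0 False w)"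
    and s: "\<And>g. run_sum g False 0 z = run_sum g False 0 w + (g i + g j)"
    using two_sticky_dup[OF z] by metis
  obtain i' j' where ij': "i' \<le> length w + 1" "j' \<le> length w + 1"
    and dup': "z' = dup j' 0 False (dup i' 0 False w)"
    and s': "\<And>g. run_sum g False 0 z' = run_sum g False 0 w + (g i' + g j')"
    using two_sticky_dup[OF z'] by metis
  have "i = i' \<and> j = j' \<or> i = j' \<and> j = i'"
  proof (rule pair_eq_if_power_sums_eq[OF p(1,2)])
    show "int p dvd int (i + j) - int (i' + j')"
      using eq by (intro int_dvd_diff_if_mod_eq[of "run_sum (\<lambda>i. i) False 0 w"])
        (simp add: signature_def s s')
    show "int p dvd int (i\<^sup>2 + j\<^sup>2) - int (i'\<^sup>2 + j'\<^sup>2)"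
      using eq by (intro int_dvd_diff_if_mod_eq[of "run_sum (\<lambda>i. i\<^sup>2) False 0 w"])
        (simp add: signature_def s s')
  qed (use ij ij' p in auto)
  then show ?thesis using dup dup' dup_commute by auto
qed

text \<open>For fixed \<open>w\<close> only \<open>- 2 * j\<close> varies in the sum of run indices,
  and 2 is invertible modulo \<open>p\<close>.\<close>

lemma signature_alternation_unique:
  assumes p: "prime p" "2 < p" "length w < p"
    and z: "alternation w z" and z': "alternation w z'" and eq: "signature p z = signature p z'"
  shows "z = z'"
proof -
  obtain j where j: "j \<le> length w" "z = alt_ins j 0 False w"
    and s: "run_sum (\<lambda>i. i) False 0 z + 2 * j = run_sum (\<lambda>i. i) False 0 w + 3 + 2 * length w"
    using alternation_alt_ins[OF z] by metis
  obtain j' where j': "j' \<le> length w" "z' = alt_ins j' 0 False w"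
    and s': "run_sum (\<lambda>i. i) False 0 z' + 2 * j' = run_sum (\<lambda>i. i) False 0 w + 3 + 2 * length w"
    using alternation_alt_ins[OF z'] by metis
  have "int p dvd int (run_sum (\<lambda>i. i) False 0 z) - int (run_sum (\<lambda>i. i) False 0 z')"
    using eq by (intro int_dvd_diff_if_mod_eq[of 0]) (simp add: signature_def)
  also have "int a - int b = 2 * (int j' - int j)" if "a + 2 * j = c" "b + 2 * j' = c" for a b c
  proof -
    have "int a + 2 * int j = int b + 2 * int j'" using that by (metis of_nat_add of_nat_mult of_nat_numeral)
    then show ?thesis by simp
  qed
  note this[OF s s']
  finally have "int p dvd 2 * (int j' - int j)" .
  moreover have "prime (int p)" using p by simp
  moreover have "\<not> int p dvd 2" using p(2) zdvd_imp_le[of "int p" 2] by auto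
  ultimately have "int p dvd int j' - int j" using prime_dvd_multD by blast
  then have "j' = j" using eq_if_int_dvd_diff j(1) j'(1) p(3) by (meson le_less_trans)
  then show ?thesis using j j' by simp
qed

text \<open>Doublings preserve the number of flips and an alternation adds 2, which is visible
  modulo 4.\<close>

lemma two_sticky_alternation_False:
  assumes "sticky w y" "sticky y z" "alternation w z'" "signature p z = signature p z'"
  shows False
proof -
  have "flips False z = flips False w" using two_sticky_dup[OF assms(1,2)] by metis
  moreover have "flips False z' = flips False w + 2" using alternation_alt_ins[OF assms(3)] by metis
  ultimately have "flips False w mod 4 = (flips False w + 2) mod 4"
    using assms(4) by (simp add: signature_def)
  then show False by presburger
qed

text \<open>Equal lengths force the same number of missing bits on both sides; if two are missing,
  the flips decide the type of expansion.\<close>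

lemma signature_expands_unique:
  assumes p: "prime p" "2 < p" "length z < p" and len: "length z = length z'"
    and z: "expands 2 w z" and z': "expands 2 w z'" and eq: "signature p z = signature p z'"
  shows "z = z'"
  using z
proof (cases rule: expands_2_cases)
  case 1
  from z' show ?thesis
    by (cases rule: expands_2_cases)
      (use 1 len in \<open>auto dest!: sticky_length alternation_length\<close>)
next
  case 2
  note l = sticky_length[OF 2]
  from z' show ?thesis
  proof (cases rule: expands_2_cases)
    case 1
    then show ?thesis using l len by simp
  next
    case 2
    then show ?thesis using signature_sticky_unique[OF _ \<open>sticky w z\<close> 2 eq] l p by simp
  next
    case (3 y')
    then show ?thesis using l len sticky_length[OF 3(1)] sticky_length[OF 3(2)] by simp
  next
    case 4
    then show ?thesis using l len alternation_length[OF 4] by simp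
  qed
next
  case (3 y)
  note l = sticky_length[OF 3(1)] sticky_length[OF 3(2)]
  from z' show ?thesis
  proof (cases rule: expands_2_cases)
    case 1
    then show ?thesis using l len by simp
  next
    case 2
    then show ?thesis using l len sticky_length[OF 2] by simp
  next
    case (3 y')
    then show ?thesis
      using signature_two_sticky_unique[OF p(1,2) _ \<open>sticky w y\<close> \<open>sticky y z\<close> 3 eq] l p by simp
  next
    case 4
    then show ?thesis using two_sticky_alternation_False[OF 3 4 eq] by simp
  qed
next
  case 4
  note l = alternation_length[OF 4]
  from z' show ?thesis
  proof (cases rule: expands_2_cases)
    case 1
    then show ?thesis using l len by simp
  next
    case 2
    then show ?thesis using l len sticky_length[OF 2] by simp
  next
    case (3 y')
    then show ?thesis using two_sticky_alternation_False[OF 3 4 eq[symmetric]] by simp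
  next
    case 4
    then show ?thesis
      using signature_alternation_unique[OF p(1,2) _ \<open>alternation w z\<close> 4 eq] l p by simp
  qed
qed

section \<open>The code, its size and its redundancy\<close>

definition signature_code :: "bool list \<Rightarrow> bool list \<Rightarrow> nat \<Rightarrow> nat \<Rightarrow> nat \<times> nat \<times> nat \<Rightarrow> bool list set" where
  "signature_code u v n p s = {x \<in> words n. signature p (u @ x @ v) = s}"

lemma uniquely_decodable_signature_code:
  assumes "length u = 3" "length v = 3" "prime p" "n + 6 < p"
  shows "uniquely_decodable u v 2 (signature_code u v n p s)"
  unfolding uniquely_decodable_def
proof (intro ballI impI)
  fix x y assume xy: "x \<in> signature_code u v n p s" "y \<in> signature_code u v n p s" "x \<noteq> y"
  show "received u v 2 x \<inter> received u v 2 y = {}"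
  proof (rule ccontr)
    assume "received u v 2 x \<inter> received u v 2 y \<noteq> {}"
    then obtain R where R: "R \<in> received u v 2 x" "R \<in> received u v 2 y" by auto
    have "u @ x @ v = u @ y @ v"
    proof (rule signature_expands_unique[OF assms(3)])
      show "expands 2 (merge R) (u @ x @ v)" "expands 2 (merge R) (u @ y @ v)"
        using received_expands assms(1,2) R by blast+
    qed (use xy assms in \<open>auto simp: signature_code_def words_def\<close>)
    then show False using xy(3) by simp
  qed
qed

lemma finite_words: "finite (words n)" and card_words: "card (words n) = 2 ^ n"
  using finite_lists_length_eq[of "UNIV :: bool set" n] card_lists_length_eq[of "UNIV :: bool set" n]
  by (simp_all add: words_def)

text \<open>Pigeonhole over the \<open>4 * p\<^sup>2\<close> possible signatures.\<close>

lemma large_signature_code: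
  assumes "0 < p"
  obtains s where "2 ^ n \<le> card (signature_code u v n p s) * (4 * p\<^sup>2)"
proof -
  let ?B = "{..<4::nat} \<times> {..<p} \<times> {..<p}" and ?f = "\<lambda>x. signature p (u @ x @ v)"
  have "?f \<in> words n \<rightarrow> ?B" using assms by (auto simp: signature_def)
  moreover have "finite ?B" by simp
  moreover have "(0, 0, 0) \<in> ?B" using assms by simp
  then have "?B \<noteq> {}" by blast
  ultimately obtain s where "card (words n) \<le> card (?f -` {s} \<inter> words n) * card ?B"
    using pigeonhole_card[OF _ finite_words, of ?f] by meson
  moreover have "?f -` {s} \<inter> words n = signature_code u v n p s"
    by (auto simp: signature_code_def)
  ultimately show thesis
    using that by (simp add: card_words card_cartesian_product power2_eq_square mult_ac)
qed

lemma redundancy_le: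
  assumes "2 ^ n \<le> card C * (4 * p\<^sup>2)" "p \<le> K * n" "0 < p" "1 \<le> n"
  shows "redundancy n C \<le> 2 * log 2 (real n) + (2 + 2 * log 2 (real K))"
proof -
  have C: "card C > 0" using assms(1) by (auto intro: Nat.gr0I)
  have K: "K > 0" using assms by (auto intro: Nat.gr0I)
  have "real (2 ^ n) \<le> real (card C * (4 * p\<^sup>2))" using assms(1) by (simp only: of_nat_le_iff)
  then have "2 ^ n / real (card C) \<le> 4 * (real p)\<^sup>2" using C by (simp add: field_simps)
  also have "\<dots> \<le> 4 * (real K * real n)\<^sup>2"
    using assms(2) by (simp add: power_mono flip: of_nat_mult)
  finally have "redundancy n C \<le> log 2 (4 * (real K * real n)\<^sup>2)"
    unfolding redundancy_def using C by (intro log_mono) auto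
  also have "\<dots> = log 2 4 + 2 * (log 2 (real K) + log 2 (real n))"
    using K assms(4) by (simp add: log_mult log_nat_power)
  also have "log 2 4 = (2::real)" using log_nat_power[of 2 2 2] by simp
  finally show ?thesis by simp
qed


section \<open>Circuits\<close>

lemma run_gates_append: "run_gates (gs @ gs') ws = run_gates gs' (run_gates gs ws)"
  by (induction gs arbitrary: ws) auto

lemma length_run_gates: "length (run_gates gs ws) = length ws + length gs"
  by (induction gs arbitrary: ws) auto

text \<open>\<open>F\<close> holds functions available on the wires of one circuit, so an
  intermediate result is computed once and shared.\<close>

definition computes :: "nat \<Rightarrow> nat \<Rightarrow> (bool list \<Rightarrow> bool) set \<Rightarrow> bool" where
  "computes m s F \<longleftrightarrow>
     (\<exists>gs. length gs \<le> s \<and>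
        (\<forall>k < length gs. \<forall>w \<in> set_gate (gs ! k). w < m + k) \<and>
        (\<forall>f \<in> F. \<exists>w < m + length gs. \<forall>inp. length inp = m \<longrightarrow> run_gates gs inp ! w = f inp))"

lemma computes_inputs: "computes m 0 {\<lambda>inp. inp ! i | i. i < m}"
  unfolding computes_def by (intro exI[of _ "[]"]) auto

lemma computes_mono: "computes m s F \<Longrightarrow> s \<le> s' \<Longrightarrow> F' \<subseteq> F \<Longrightarrow> computes m s' F'"
  unfolding computes_def by (elim exE conjE, rule exI, intro conjI) auto

text \<open>A gate in which every wire is replaced by the function that the wire carries.\<close>

fun gate_fun :: "(bool list \<Rightarrow> bool) gate \<Rightarrow> bool list \<Rightarrow> bool" where
  "gate_fun (ConstG b) inp = b"
| "gate_fun (NotG f) inp = (\<not> f inp)"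
| "gate_fun (AndG f g) inp = (f inp \<and> g inp)"
| "gate_fun (OrG f g) inp = (f inp \<or> g inp)"

lemma computes_gate:
  assumes "computes m s F" "set_gate g \<subseteq> F"
  shows "computes m (s + 1) (insert (gate_fun g) F)"
proof -
  obtain gs where gs: "length gs \<le> s" "\<forall>k < length gs. \<forall>w \<in> set_gate (gs ! k). w < m + k"
    and F: "\<forall>f \<in> F. \<exists>w < m + length gs. \<forall>inp. length inp = m \<longrightarrow> run_gates gs inp ! w = f inp"
    using assms(1) unfolding computes_def by blast
  obtain W where W: "\<forall>f \<in> F. W f < m + length gs \<and> (\<forall>inp. length inp = m \<longrightarrow> run_gates gs inp ! W f = f inp)"
    using bchoice[OF F] by auto
  define h where "h = map_gate W g"
  let ?gs = "gs @ [h]"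
  have val: "gate_value (run_gates gs inp) h = gate_fun g inp" if "length inp = m" for inp
    unfolding h_def using assms(2) W that by (cases g) auto
  have run: "run_gates ?gs inp = run_gates gs inp @ [gate_value (run_gates gs inp) h]" for inp
    by (simp add: run_gates_append)
  have "\<forall>k < length ?gs. \<forall>w \<in> set_gate (?gs ! k). w < m + k"
    using gs(2) assms(2) W by (auto simp: nth_append less_Suc_eq h_def gate.set_map)
  moreover have "\<exists>w < m + length ?gs. \<forall>inp. length inp = m \<longrightarrow> run_gates ?gs inp ! w = f inp"
    if "f \<in> insert (gate_fun g) F" for f
  proof (cases "f = gate_fun g")
    case True
    then show ?thesis
      by (intro exI[of _ "m + length gs"]) (auto simp: run val nth_append length_run_gates)
  next
    case False
    then have "f \<in> F" using that by simp
    then show ?thesis using W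
      by (intro exI[of _ "W f"]) (auto simp: run nth_append length_run_gates)
  qed
  ultimately show ?thesis
    unfolding computes_def using gs(1) by (intro exI[of _ ?gs]) auto
qed

text \<open>Quantifying over every circuit that already carries \<open>F\<close> makes costs add
  under composition, without any tracking of wire numbers.\<close>

definition derives :: "nat \<Rightarrow> nat \<Rightarrow> (bool list \<Rightarrow> bool) set \<Rightarrow> (bool list \<Rightarrow> bool) set \<Rightarrow> bool" where
  "derives m c F G \<longleftrightarrow> (\<forall>s H. F \<subseteq> H \<longrightarrow> computes m s H \<longrightarrow> computes m (s + c) (H \<union> G))"

lemma derives_subset: "G \<subseteq> F \<Longrightarrow> derives m 0 F G"
  unfolding derives_def by (auto simp: Un_absorb2)

lemma derives_gate: "set_gate g \<subseteq> F \<Longrightarrow> derives m 1 F {gate_fun g}"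
  unfolding derives_def using computes_gate by (simp add: subset_trans)

lemma derives_mono:
  "derives m c F G \<Longrightarrow> c \<le> c' \<Longrightarrow> F \<subseteq> F' \<Longrightarrow> G' \<subseteq> G \<Longrightarrow> derives m c' F' G'"
  unfolding derives_def
proof (intro allI impI)
  fix s H assume d: "\<forall>s H. F \<subseteq> H \<longrightarrow> computes m s H \<longrightarrow> computes m (s + c) (H \<union> G)"
    and *: "c \<le> c'" "F \<subseteq> F'" "G' \<subseteq> G" "F' \<subseteq> H" "computes m s H"
  then have "computes m (s + c) (H \<union> G)" by blast
  then show "computes m (s + c') (H \<union> G')" by (rule computes_mono) (use * in auto)
qed

lemma derives_trans:
  assumes "derives m c F G" "derives m d (F \<union> G) G'"
  shows "derives m (c + d) F (G \<union> G')"
  unfolding derives_def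
proof (intro allI impI)
  fix s H assume "F \<subseteq> H" "computes m s H"
  then have "computes m (s + c) (H \<union> G)" using assms(1) by (auto simp: derives_def)
  moreover have "F \<union> G \<subseteq> H \<union> G" using \<open>F \<subseteq> H\<close> by auto
  ultimately have "computes m (s + c + d) (H \<union> G \<union> G')" using assms(2) by (auto simp: derives_def)
  then show "computes m (s + (c + d)) (H \<union> (G \<union> G'))" by (simp add: add.assoc Un_assoc)
qed

lemma derives_UN:
  assumes "finite I" "\<And>i. i \<in> I \<Longrightarrow> derives m c F (G i)"
  shows "derives m (c * card I) F (\<Union>i\<in>I. G i)"
  using assms
proof (induction I)
  case empty
  then show ?case by (simp add: derives_subset)
next
  case (insert i I)
  have "derives m c (F \<union> (\<Union>i\<in>I. G i)) (G i)"
    using insert.prems[of i] by (rule derives_mono) auto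
  then have "derives m (c * card I + c) F ((\<Union>i\<in>I. G i) \<union> G i)"
    using insert by (intro derives_trans) auto
  then show ?case using insert by (simp add: Un_commute add.commute)
qed

lemma derives_const: "derives m 1 F {\<lambda>_. b}"
proof -
  have "gate_fun (ConstG b) = (\<lambda>_. b)" by auto
  then show ?thesis using derives_gate[of "ConstG b" F m] by simp
qed

lemma derives_not: "f \<in> F \<Longrightarrow> derives m 1 F {\<lambda>inp. \<not> f inp}"
proof -
  assume "f \<in> F"
  moreover have "gate_fun (NotG f) = (\<lambda>inp. \<not> f inp)" by auto
  ultimately show ?thesis using derives_gate[of "NotG f" F m] by simp
qed

lemma derives_and: "f \<in> F \<Longrightarrow> g \<in> F \<Longrightarrow> derives m 1 F {\<lambda>inp. f inp \<and> g inp}"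
proof -
  assume "f \<in> F" "g \<in> F"
  moreover have "gate_fun (AndG f g) = (\<lambda>inp. f inp \<and> g inp)" by auto
  ultimately show ?thesis using derives_gate[of "AndG f g" F m] by simp
qed

lemma derives_or: "f \<in> F \<Longrightarrow> g \<in> F \<Longrightarrow> derives m 1 F {\<lambda>inp. f inp \<or> g inp}"
proof -
  assume "f \<in> F" "g \<in> F"
  moreover have "gate_fun (OrG f g) = (\<lambda>inp. f inp \<or> g inp)" by auto
  ultimately show ?thesis using derives_gate[of "OrG f g" F m] by simp
qed

lemma derives_chain:
  assumes "derives m c F G" "derives m d (F \<union> G) G'"
  shows "derives m (c + d) F G'"
  using derives_trans[OF assms] by (rule derives_mono) auto

lemma derives_if:
  assumes "b \<in> F" "f \<in> F" "g \<in> F"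
  shows "derives m 4 F {\<lambda>inp. if b inp then f inp else g inp}"
proof -
  let ?n = "\<lambda>inp. \<not> b inp" and ?p = "\<lambda>inp. b inp \<and> f inp"
  let ?q = "\<lambda>inp. \<not> b inp \<and> g inp"
  have "derives m 1 F {?n}" "derives m 1 (F \<union> {?n}) {?p}"
    "derives m 1 (F \<union> {?n} \<union> {?p}) {?q}"
    "derives m 1 (F \<union> {?n} \<union> {?p} \<union> {?q}) {\<lambda>inp. ?p inp \<or> ?q inp}"
    by (rule derives_not derives_and derives_or; use assms in simp)+
  then have "derives m (1 + (1 + (1 + 1))) F {\<lambda>inp. ?p inp \<or> ?q inp}"
    by (intro derives_chain)
  moreover have "(\<lambda>inp. ?p inp \<or> ?q inp) = (\<lambda>inp. if b inp then f inp else g inp)" by auto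
  moreover have "1 + (1 + (1 + 1)) = (4::nat)" by simp
  ultimately show ?thesis by (simp only:)
qed

lemma derives_all:
  assumes "finite I" "\<And>i. i \<in> I \<Longrightarrow> f i \<in> F"
  shows "derives m (card I + 1) F {\<lambda>inp. \<forall>i\<in>I. f i inp}"
  using assms
proof (induction I)
  case empty
  then show ?case using derives_const[of m F True] by simp
next
  case (insert i I)
  let ?g = "\<lambda>inp. \<forall>i\<in>I. f i inp"
  have "derives m 1 (F \<union> {?g}) {\<lambda>inp. f i inp \<and> ?g inp}"
    using insert.prems by (intro derives_and) auto
  moreover have "derives m (card I + 1) F {?g}" using insert by auto
  ultimately have "derives m (card I + 1 + 1) F {\<lambda>inp. f i inp \<and> ?g inp}"
    by (rule derives_chain[rotated])
  then show ?case using insert by simp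
qed

lemma derives_ex:
  assumes "finite I" "\<And>i. i \<in> I \<Longrightarrow> f i \<in> F"
  shows "derives m (card I + 1) F {\<lambda>inp. \<exists>i\<in>I. f i inp}"
  using assms
proof (induction I)
  case empty
  then show ?case using derives_const[of m F False] by simp
next
  case (insert i I)
  let ?g = "\<lambda>inp. \<exists>i\<in>I. f i inp"
  have "derives m 1 (F \<union> {?g}) {\<lambda>inp. f i inp \<or> ?g inp}"
    using insert.prems by (intro derives_or) auto
  moreover have "derives m (card I + 1) F {?g}" using insert by auto
  ultimately have "derives m (card I + 1 + 1) F {\<lambda>inp. f i inp \<or> ?g inp}"
    by (rule derives_chain[rotated])
  then show ?case using insert by simp
qed

text \<open>Read from the last bit to the first, the layers of an automaton become multiplexers: the
  verdict from state \<open>q\<close> on is selected by the next bit between the verdicts from its two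
  successors.\<close>

lemma derives_automaton:
  assumes Q: "\<And>k. finite (Q k)" "\<And>k. card (Q k) \<le> B"
    and step: "\<And>k q b. q \<in> Q (Suc k) \<Longrightarrow> step q b \<in> Q k"
    and bits: "\<And>i. i \<in> set ps \<Longrightarrow> (\<lambda>inp. inp ! i) \<in> F"
  shows "derives m (4 * B * (length ps + 1)) F
           {\<lambda>inp. P (foldl step q (map (\<lambda>i. inp ! i) ps)) | q. q \<in> Q (length ps)}"
  using bits
proof (induction ps)
  case Nil
  have "derives m (1 * card (Q 0)) F (\<Union>q\<in>Q 0. {\<lambda>inp. P q})"
    by (intro derives_UN Q derives_const)
  then show ?case
    by (rule derives_mono) (use Q(2)[of 0] in auto)
next
  case (Cons i ps)
  \<comment> \<open>\<open>Q k\<close> holds the states possible with \<open>k\<close> bits still to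
    read, so reading \<open>i\<close> leads from \<open>Q ?k\<close> to
    \<open>Q (length ps)\<close>.\<close>
  let ?G = "\<lambda>ps. {\<lambda>inp. P (foldl step q (map (\<lambda>i. inp ! i) ps)) | q. q \<in> Q (length ps)}"
  let ?k = "Suc (length ps)"
  have mux: "derives m 4 (F \<union> ?G ps) {\<lambda>inp. P (foldl step q (map (\<lambda>i. inp ! i) (i # ps)))}"
    if "q \<in> Q ?k" for q
  proof -
    have "derives m 4 (F \<union> ?G ps) {\<lambda>inp. if inp ! i
        then P (foldl step (step q True) (map (\<lambda>i. inp ! i) ps))
        else P (foldl step (step q False) (map (\<lambda>i. inp ! i) ps))}"
      using Cons.prems[of i] step[OF that] by (intro derives_if) auto
    moreover have "(\<lambda>inp. if inp ! i
        then P (foldl step (step q True) (map (\<lambda>i. inp ! i) ps))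
        else P (foldl step (step q False) (map (\<lambda>i. inp ! i) ps)))
      = (\<lambda>inp. P (foldl step q (map (\<lambda>i. inp ! i) (i # ps))))"
      by (auto simp: fun_eq_iff)
    ultimately show ?thesis by simp
  qed
  have "derives m (4 * card (Q ?k)) (F \<union> ?G ps)
      (\<Union>q\<in>Q ?k. {\<lambda>inp. P (foldl step q (map (\<lambda>i. inp ! i) (i # ps)))})"
    by (intro derives_UN Q mux)
  then have "derives m (4 * B) (F \<union> ?G ps) (?G (i # ps))"
    by (rule derives_mono) (use Q(2)[of ?k] in auto)
  then have "derives m (4 * B * (length ps + 1) + 4 * B) F (?G (i # ps))"
    using Cons by (intro derives_chain[of m _ F "?G ps"]) simp_all
  then show ?case by (simp add: algebra_simps)
qed

lemma circuit_of_derives: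
  assumes "derives m s {\<lambda>inp. inp ! i | i. i < m} (set fs)"
  obtains c where "circuit_wf m c" "circuit_size c \<le> s"
    "\<And>inp. length inp = m \<Longrightarrow> run_circuit c inp = map (\<lambda>f. f inp) fs"
proof -
  have "computes m s (set fs)"
  proof (rule computes_mono)
    show "computes m (0 + s) ({\<lambda>inp. inp ! i | i. i < m} \<union> set fs)"
      using assms computes_inputs[of m] unfolding derives_def by blast
  qed auto
  then obtain gs where gs: "length gs \<le> s" "\<forall>k < length gs. \<forall>w \<in> set_gate (gs ! k). w < m + k"
    and F: "\<forall>f \<in> set fs. \<exists>w < m + length gs. \<forall>inp. length inp = m \<longrightarrow> run_gates gs inp ! w = f inp"
    unfolding computes_def by blast
  obtain W where W: "\<forall>f \<in> set fs. W f < m + length gs \<and> (\<forall>inp. length inp = m \<longrightarrow> run_gates gs inp ! W f = f inp)"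
    using bchoice[OF F] by auto
  show thesis
    by (rule that[of "Circuit gs (map W fs)"])
      (use gs W in \<open>auto simp: circuit_wf_def circuit_size_def run_circuit_def\<close>)
qed


section \<open>The decoder\<close>

text \<open>The sums are kept unreduced; being polynomially bounded in the length, they give a
  number of states independent of \<open>p\<close>.\<close>

fun signature_step :: "bool \<times> nat \<times> nat \<times> nat \<Rightarrow> bool \<Rightarrow> bool \<times> nat \<times> nat \<times> nat" where
  "signature_step (a, k, s, t) b =
     (let k' = k + of_bool (a \<noteq> b) in (b, k', s + k', t + k'\<^sup>2))"

abbreviation signature_state :: "bool list \<Rightarrow> bool \<times> nat \<times> nat \<times> nat" where
  "signature_state \<equiv> foldl signature_step (False, 0, 0, 0)"

lemma foldl_signature_step:
  "foldl signature_step (a, k, s, t) z =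
     (last (a # z), k + flips a z, s + run_sum (\<lambda>i. i) a k z, t + run_sum (\<lambda>i. i\<^sup>2) a k z)"
  by (induction z arbitrary: a k s t) (auto simp: Let_def)

lemma signature_conv_state:
  "signature p z = (case signature_state z of (a, k, s, t) \<Rightarrow> (k mod 4, s mod p, t mod p))"
  by (simp add: foldl_signature_step signature_def)

lemma run_sum_le:
  assumes "mono g"
  shows "run_sum g a k z \<le> length z * g (k + length z)"
proof (induction z arbitrary: a k)
  case (Cons b z)
  let ?k = "k + of_bool (a \<noteq> b)"
  have "run_sum g b ?k z \<le> length z * g (?k + length z)" by (rule Cons.IH)
  also have "\<dots> \<le> length z * g (k + length (b # z))"
    using monoD[OF assms, of "?k + length z" "k + length (b # z)"] by (intro mult_le_mono2) auto
  finally show ?case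
    using monoD[OF assms, of ?k "k + length (b # z)"] by auto
qed simp

lemma card_signature_states:
  assumes "\<And>w. w \<in> W \<Longrightarrow> length w \<le> N"
  shows "finite (signature_state ` W)"
    "card (signature_state ` W) \<le> 2 * (N + 1) * (N ^ 2 + 1) * (N ^ 3 + 1)"
proof -
  let ?B = "(UNIV :: bool set) \<times> {..N} \<times> {..N ^ 2} \<times> {..N ^ 3}"
  have "signature_state w \<in> ?B" if "w \<in> W" for w
  proof -
    have N: "length w \<le> N" using assms that by simp
    have "run_sum (\<lambda>i. i) False 0 w \<le> length w * length w"
      using run_sum_le[of "\<lambda>i. i" False 0 w] by (simp add: mono_def)
    also have "\<dots> \<le> N * N" using N by (intro mult_le_mono)
    finally have 1: "run_sum (\<lambda>i. i) False 0 w \<le> N ^ 2" by (simp add: power2_eq_square)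
    have "run_sum (\<lambda>i. i\<^sup>2) False 0 w \<le> length w * (length w)\<^sup>2"
      using run_sum_le[of "\<lambda>i. i\<^sup>2" False 0 w] by (simp add: mono_def power_mono)
    also have "\<dots> \<le> N * N\<^sup>2" using N by (intro mult_le_mono power_mono) auto
    finally have 2: "run_sum (\<lambda>i. i\<^sup>2) False 0 w \<le> N ^ 3" by (simp add: power2_eq_square power3_eq_cube)
    show ?thesis
      using 1 2 N flips_le_length[of False w] by (auto simp: foldl_signature_step)
  qed
  then have sub: "signature_state ` W \<subseteq> ?B" by blast
  have fin: "finite ?B" by simp
  show "finite (signature_state ` W)" using sub fin by (rule finite_subset)
  have "card (signature_state ` W) \<le> card ?B" using sub fin by (rule card_mono[rotated])
  also have "card ?B = 2 * (N + 1) * (N ^ 2 + 1) * (N ^ 3 + 1)"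
    by (simp only: card_cartesian_product card_atMost card_UNIV_bool Suc_eq_plus1 mult.assoc)
  finally show "card (signature_state ` W) \<le> 2 * (N + 1) * (N ^ 2 + 1) * (N ^ 3 + 1)" .
qed

text \<open>The fixed words are absorbed into the automaton: \<open>u\<close> into its start state,
  \<open>v\<close> into the verdict \<open>?P\<close>.\<close>

lemma derives_signature:
  assumes "length ps = n" "\<And>i. i \<in> set ps \<Longrightarrow> (\<lambda>inp. inp ! i) \<in> F" "length u = 3"
  shows "derives m (4 * (2 * (n + 4) * ((n + 3) ^ 2 + 1) * ((n + 3) ^ 3 + 1)) * (n + 1)) F
           {\<lambda>inp. signature p (u @ map (\<lambda>i. inp ! i) ps @ v) = s}"
proof -
  \<comment> \<open>The prefixes that can have been read when \<open>k\<close> bits of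
    \<open>x\<close> remain; the empty default for \<open>k > n\<close> makes the step condition
    vacuous there.\<close>
  define W where "W k = (if k \<le> n then (@) u ` words (n - k) else {})" for k
  let ?Q = "\<lambda>k. signature_state ` W k"
  let ?B = "2 * (n + 4) * ((n + 3) ^ 2 + 1) * ((n + 3) ^ 3 + 1)"
  let ?P = "\<lambda>q. (case foldl signature_step q v of (a, k, s, t) \<Rightarrow> (k mod 4, s mod p, t mod p)) = s"
  have len: "length w \<le> n + 3" if "w \<in> W k" for w k
    using that assms(3) by (auto simp: W_def words_def split: if_splits)
  have step: "signature_step q b \<in> ?Q k" if q: "q \<in> ?Q (Suc k)" for k q b
  proof -
    obtain x where x: "Suc k \<le> n" "length x = n - Suc k" "q = signature_state (u @ x)"
      using q by (auto simp: W_def words_def split: if_splits)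
    then have "signature_step q b = signature_state (u @ x @ [b])" by simp
    moreover have "u @ x @ [b] \<in> W k" using x by (auto simp: W_def words_def)
    ultimately show ?thesis by (metis imageI)
  qed
  have "derives m (4 * ?B * (length ps + 1)) F
          {\<lambda>inp. ?P (foldl signature_step q (map (\<lambda>i. inp ! i) ps)) | q. q \<in> ?Q (length ps)}"
  proof (rule derives_automaton)
    fix k
    show "finite (?Q k)" by (rule card_signature_states(1)) (rule len)
    have "card (?Q k) \<le> 2 * ((n + 3) + 1) * ((n + 3) ^ 2 + 1) * ((n + 3) ^ 3 + 1)"
      by (rule card_signature_states(2)) (rule len)
    also have "n + 3 + 1 = n + 4" by simp
    finally show "card (?Q k) \<le> ?B" .
  qed (use step assms(2) in auto)
  then show ?thesis
  proof (rule derives_mono)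
    have "signature_state u \<in> ?Q (length ps)"
      using assms(1) by (auto simp: W_def words_def)
    moreover have "(signature p (u @ map (\<lambda>i. inp ! i) ps @ v) = s)
        = ?P (foldl signature_step (signature_state u) (map (\<lambda>i. inp ! i) ps))" for inp
      by (simp add: signature_conv_state)
    ultimately show "{\<lambda>inp. signature p (u @ map (\<lambda>i. inp ! i) ps @ v) = s}
        \<subseteq> {\<lambda>inp. ?P (foldl signature_step q (map (\<lambda>i. inp ! i) ps)) | q. q \<in> ?Q (length ps)}"
      by blast
  qed (use assms(1) in auto)
qed

section \<open>Tracing received bits to positions of the word\<close>

lemma concat_triples:
  "concat (map (\<lambda>i. [f i, f (i + 1), f (i + 2)]) l) =
     map (\<lambda>i. f (l ! (i div 3) + i mod 3)) [0..<3 * length l]"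
proof (induction l rule: rev_induct)
  case (snoc a l)
  have "[0..<3 * length (l @ [a])] = [0..<3 * length l] @ [3 * length l, 3 * length l + 1, 3 * length l + 2]"
    by (simp add: upt_add_eq_append[of 0 "3 * length l" 3, simplified] eval_nat_numeral)
  moreover have "i div 3 < length l" if "i < 3 * length l" for i using that by auto
  moreover have "Suc (3 * m) div 3 = m" "Suc (Suc (3 * m)) div 3 = m"
    "Suc (3 * m) mod 3 = 1" "Suc (Suc (3 * m)) mod 3 = 2" for m :: nat
    by presburger+
  ultimately show ?case using snoc by (simp add: nth_append)
qed simp

definition surviving_reads :: "nat \<Rightarrow> nat set \<Rightarrow> nat list" where
  "surviving_reads n D = nths [0..<n + 4] (- D)"

text \<open>The position in the word from which input bit \<open>i\<close> is copied: bit
  \<open>i mod 3\<close> of surviving read \<open>i div 3\<close>.\<close>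

definition source :: "nat \<Rightarrow> nat set \<Rightarrow> nat \<Rightarrow> nat" where
  "source n D i = surviving_reads n D ! (i div 3) + i mod 3"

lemma surviving_reads:
  assumes "D \<subseteq> {0<..<n + 3}" "card D = 2"
  shows "length (surviving_reads n D) = n + 2" "set (surviving_reads n D) = {..<n + 4} - D"
proof -
  have "finite D" using assms(1) finite_subset by blast
  have "{i. i < n + 4 \<and> i \<in> - D} = {..<n + 4} - D" by auto
  moreover have "D \<subseteq> {..<n + 4}" using assms(1) by auto
  ultimately show "length (surviving_reads n D) = n + 2"
    using \<open>finite D\<close> assms(2) by (simp add: surviving_reads_def length_nths card_Diff_subset)
  show "set (surviving_reads n D) = {..<n + 4} - D"
  proof (safe)
    fix i assume "i < n + 4" "i \<notin> D"
    then show "i \<in> set (surviving_reads n D)"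
      unfolding surviving_reads_def set_nths by (intro CollectI exI[of _ i]) auto
  qed (auto simp: surviving_reads_def set_nths)
qed

lemma concat_received:
  assumes "D \<subseteq> {0<..<n + 3}" "card D = 2" "length z = n + 6"
  shows "concat (nths (read_vector z) (- D)) = map (\<lambda>i. z ! source n D i) [0..<3 * (n + 2)]"
proof -
  have "nths (read_vector z) (- D) = map (\<lambda>i. take 3 (drop i z)) (surviving_reads n D)"
  proof -
    have "length z - 2 = n + 4" using assms(3) by simp
    then show ?thesis by (simp only: read_vector_def nths_map surviving_reads_def)
  qed
  also have "\<dots> = map (\<lambda>i. [z ! i, z ! (i + 1), z ! (i + 2)]) (surviving_reads n D)"
  proof (rule map_cong[OF refl])
    fix i assume "i \<in> set (surviving_reads n D)"
    then have "i + 2 < length z" using surviving_reads(2)[OF assms(1,2)] assms(3) by auto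
    then show "take 3 (drop i z) = [z ! i, z ! (i + 1), z ! (i + 2)]"
      by (simp add: numeral_3_eq_3 Cons_nth_drop_Suc[symmetric])
  qed
  finally show ?thesis
    by (simp only: concat_triples[of "\<lambda>i. z ! i"] surviving_reads(1)[OF assms(1,2)] source_def)
qed

lemma source_less:
  assumes "D \<subseteq> {0<..<n + 3}" "card D = 2" "i < 3 * (n + 2)"
  shows "source n D i < n + 6"
proof -
  have "i div 3 < length (surviving_reads n D)" using surviving_reads(1)[OF assms(1,2)] assms(3) by auto
  then have "surviving_reads n D ! (i div 3) < n + 4"
    using nth_mem surviving_reads(2)[OF assms(1,2)] by fastforce
  moreover have "i mod 3 < 3" by simp
  ultimately show ?thesis unfolding source_def by linarith
qed

text \<open>Every bit of the codeword lies in three reads, so one of them survives.\<close>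

lemma ex_source:
  assumes "D \<subseteq> {0<..<n + 3}" "card D = 2" "k < n"
  shows "\<exists>i < 3 * (n + 2). source n D i = k + 3"
proof -
  have "finite D" using assms(1) finite_subset by blast
  have "\<not> {k + 1, k + 2, k + 3} \<subseteq> D"
  proof
    assume "{k + 1, k + 2, k + 3} \<subseteq> D"
    then have "card {k + 1, k + 2, k + 3} \<le> card D" using \<open>finite D\<close> by (rule card_mono[rotated])
    then show False using assms(2) by simp
  qed
  then consider "k + 3 - 0 \<notin> D" | "k + 3 - 1 \<notin> D" | "k + 3 - 2 \<notin> D" by auto
  then obtain r where r: "r < 3" "k + 3 - r \<notin> D"
    by cases (erule that[rotated], simp)+
  then have "k + 3 - r \<in> set (surviving_reads n D)"
    using surviving_reads(2)[OF assms(1,2)] assms(3) by auto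
  then obtain j where j: "j < n + 2" "surviving_reads n D ! j = k + 3 - r"
    using surviving_reads(1)[OF assms(1,2)] by (metis in_set_conv_nth)
  show ?thesis
    by (rule exI[of _ "3 * j + r"]) (use j r in \<open>auto simp: source_def\<close>)
qed

definition reader :: "nat \<Rightarrow> nat set \<Rightarrow> nat \<Rightarrow> nat" where
  "reader n D k = (SOME i. i < 3 * (n + 2) \<and> source n D i = k + 3)"

definition guess :: "nat \<Rightarrow> nat set \<Rightarrow> bool list \<Rightarrow> bool list" where
  "guess n D inp = map (\<lambda>k. inp ! reader n D k) [0..<n]"

text \<open>A guess is trusted only if it lies in the code and reproduces the whole input when the
  reads in \<open>D\<close> are deleted.\<close>

definition accepts ::
    "bool list \<Rightarrow> bool list \<Rightarrow> nat \<Rightarrow> nat \<Rightarrow> nat \<times> nat \<times> nat \<Rightarrow> nat set \<Rightarrow> bool list \<Rightarrow> bool" where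
  "accepts u v n p s D inp \<longleftrightarrow>
     signature p (u @ guess n D inp @ v) = s \<and>
     (\<forall>i\<in>{..<3 * (n + 2)}. inp ! i = (u @ guess n D inp @ v) ! source n D i)"

abbreviation pairs :: "nat \<Rightarrow> nat set set" where
  "pairs n \<equiv> {D. D \<subseteq> {0<..<n + 3} \<and> card D = 2}"

lemma reader:
  assumes "D \<in> pairs n" "k < n"
  shows "reader n D k < 3 * (n + 2)" "source n D (reader n D k) = k + 3"
  using someI_ex[OF ex_source[of D n k]] assms by (auto simp: reader_def)

lemma guess_received:
  assumes "D \<in> pairs n" "length u = 3" "length v = 3" "length x = n"
  shows "guess n D (concat (nths (read_vector (u @ x @ v)) (- D))) = x"
proof -
  have "guess n D (map (\<lambda>i. (u @ x @ v) ! source n D i) [0..<3 * (n + 2)]) = x"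
    using reader[OF assms(1)] assms(2,4) by (intro nth_equalityI) (auto simp: guess_def nth_append)
  moreover have "concat (nths (read_vector (u @ x @ v)) (- D))
      = map (\<lambda>i. (u @ x @ v) ! source n D i) [0..<3 * (n + 2)]"
    using assms by (intro concat_received) auto
  ultimately show ?thesis by (simp only:)
qed

text \<open>For fixed \<open>D\<close> the received bits are copies of fixed positions, and
  \<open>guess\<close> inverts this copying, so the test is exact.\<close>

lemma accepts_iff:
  assumes "D \<in> pairs n" "length u = 3" "length v = 3" "length inp = 3 * (n + 2)"
  shows "accepts u v n p s D inp \<longleftrightarrow>
    (\<exists>x \<in> signature_code u v n p s. inp = concat (nths (read_vector (u @ x @ v)) (- D)))"
proof -
  have eq: "concat (nths (read_vector (u @ x @ v)) (- D))
      = map (\<lambda>i. (u @ x @ v) ! source n D i) [0..<3 * (n + 2)]" if "length x = n" for x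
    using assms that by (intro concat_received) auto
  show ?thesis
  proof
    assume acc: "accepts u v n p s D inp"
    have len: "length (guess n D inp) = n" by (simp add: guess_def)
    have "inp = concat (nths (read_vector (u @ guess n D inp @ v)) (- D))"
      unfolding eq[OF len] using acc assms(4) by (intro nth_equalityI) (auto simp: accepts_def)
    moreover have "guess n D inp \<in> signature_code u v n p s"
      using acc len by (simp add: accepts_def signature_code_def words_def)
    ultimately show "\<exists>x \<in> signature_code u v n p s. inp = concat (nths (read_vector (u @ x @ v)) (- D))"
      by blast
  next
    assume "\<exists>x \<in> signature_code u v n p s. inp = concat (nths (read_vector (u @ x @ v)) (- D))"
    then obtain x where x: "length x = n" "signature p (u @ x @ v) = s"
      and inp: "inp = concat (nths (read_vector (u @ x @ v)) (- D))"
      by (auto simp: signature_code_def words_def)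
    have g: "guess n D inp = x" unfolding inp using guess_received assms x by blast
    have "inp = map (\<lambda>i. (u @ x @ v) ! source n D i) [0..<3 * (n + 2)]"
      using inp eq[OF x(1)] by simp
    then have "inp ! i = (u @ x @ v) ! source n D i" if "i < 3 * (n + 2)" for i
      using that by (metis add_0 diff_zero nth_map_upt)
    then show "accepts u v n p s D inp" using g x(2) by (auto simp: accepts_def)
  qed
qed

text \<open>In order: two constants, five gates to compare each of the \<open>3 * (n + 2)\<close>
  input bits, their conjunction, the automaton for the signature, a final conjunction.\<close>

abbreviation accepts_cost :: "nat \<Rightarrow> nat" where
  "accepts_cost n \<equiv> 2 + ((5 * (3 * (n + 2)) + (3 * (n + 2) + 1))
     + (4 * (2 * (n + 4) * ((n + 3) ^ 2 + 1) * ((n + 3) ^ 3 + 1)) * (n + 1) + 1))"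

lemma derives_accepts:
  assumes D: "D \<in> pairs n" and uv: "length u = 3" "length v = 3"
  shows "derives m (accepts_cost n) {\<lambda>inp. inp ! i | i. i < 3 * (n + 2)} {accepts u v n p s D}"
proof -
  let ?F = "{\<lambda>inp. inp ! i | i. i < 3 * (n + 2)}" and ?K = "\<Union>b. {\<lambda>_ :: bool list. b}"
  let ?M = "3 * (n + 2)"
  let ?F' = "?F \<union> ?K"
  let ?h = "\<lambda>i inp. (u @ guess n D inp @ v) ! source n D i"
  \<comment> \<open>Equality of input bit \<open>i\<close> with the expected bit, as a
    multiplexer.\<close>
  let ?e = "\<lambda>i inp. if inp ! i then ?h i inp else \<not> ?h i inp"
  let ?all = "\<lambda>inp. \<forall>i\<in>{..<?M}. ?e i inp"
  let ?sig = "\<lambda>inp. signature p (u @ guess n D inp @ v) = s"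
  have "derives m (1 * card (UNIV :: bool set)) ?F ?K"
    by (intro derives_UN derives_const) simp
  then have K: "derives m 2 ?F ?K" by simp
  \<comment> \<open>An expected bit is a constant from \<open>u\<close> or \<open>v\<close>, or the
    input bit that supplied the guess.\<close>
  have h: "?h i \<in> ?F'" if "i < ?M" for i
  proof -
    let ?j = "source n D i"
    have j: "?j < n + 6" using source_less[of D n i] D that by blast
    consider "?j < 3" | "3 \<le> ?j" "?j < n + 3" | "n + 3 \<le> ?j" by linarith
    then show ?thesis
    proof cases
      case 1
      then have "?h i = (\<lambda>_. u ! ?j)" using uv by (auto simp: nth_append)
      then show ?thesis by (simp only:) blast
    next
      case 2
      then have "?h i = (\<lambda>inp. inp ! reader n D (?j - 3))"
        using uv by (auto simp: nth_append guess_def)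
      moreover have "reader n D (?j - 3) < ?M" using 2 reader(1)[OF D, of "?j - 3"] by simp
      ultimately show ?thesis by blast
    next
      case 3
      then have "\<not> ?j < 3" "\<not> ?j - 3 < n" by auto
      then have "?h i = (\<lambda>_. v ! (?j - 3 - n))"
        using uv by (simp add: nth_append guess_def)
      then show ?thesis by (simp only:) blast
    qed
  qed
  have "derives m (1 + 4) ?F' {?e i}" if "i < ?M" for i
  proof (rule derives_chain)
    show "derives m 1 ?F' {\<lambda>inp. \<not> ?h i inp}" using h[OF that] by (rule derives_not)
    show "derives m 4 (?F' \<union> {\<lambda>inp. \<not> ?h i inp}) {?e i}"
      using h[OF that] that by (intro derives_if) blast+
  qed
  then have "derives m (5 * card {..<?M}) ?F' (\<Union>i\<in>{..<?M}. {?e i})"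
    by (intro derives_UN) simp_all
  then have "derives m (5 * card {..<?M} + (card {..<?M} + 1)) ?F' {?all}"
    by (rule derives_chain) (rule derives_all, auto)
  then have all: "derives m (5 * ?M + (?M + 1)) ?F' {?all}" by (simp only: card_lessThan)
  have g: "guess n D = (\<lambda>inp. map (\<lambda>i. inp ! i) (map (reader n D) [0..<n]))"
    by (simp add: guess_def comp_def fun_eq_iff)
  have "derives m (4 * (2 * (n + 4) * ((n + 3) ^ 2 + 1) * ((n + 3) ^ 3 + 1)) * (n + 1)) ?F {?sig}"
    unfolding g using reader(1)[OF D] uv by (intro derives_signature) auto
  then have sig: "derives m (4 * (2 * (n + 4) * ((n + 3) ^ 2 + 1) * ((n + 3) ^ 3 + 1)) * (n + 1))
      (?F' \<union> {?all}) {?sig}"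
    by (rule derives_mono) blast+
  have "derives m 1 (?F' \<union> {?all} \<union> {?sig}) {\<lambda>inp. ?sig inp \<and> ?all inp}"
    by (intro derives_and) auto
  then have "derives m (accepts_cost n) ?F {\<lambda>inp. ?sig inp \<and> ?all inp}"
    by (intro derives_chain[OF K] derives_chain[OF all] derives_chain[OF sig])
  moreover have "(\<lambda>inp. ?sig inp \<and> ?all inp) = accepts u v n p s D"
    by (auto simp: accepts_def fun_eq_iff)
  ultimately show ?thesis by (simp only:)
qed

abbreviation decoder_cost :: "nat \<Rightarrow> nat" where
  "decoder_cost n \<equiv> accepts_cost n * card (pairs n) + (card (pairs n) + (card (pairs n) + 1)) * n"

lemma finite_pairs: "finite (pairs n)"
  by (rule finite_subset[of _ "Pow {0<..<n + 3}"]) auto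

text \<open>The acceptance tests are computed once for all outputs; each output bit then takes one
  conjunction per pair and a disjunction over all pairs.\<close>

lemma derives_decoder:
  assumes "length u = 3" "length v = 3"
  shows "derives m (decoder_cost n) {\<lambda>inp. inp ! i | i. i < 3 * (n + 2)}
    (\<Union>k\<in>{..<n}. {\<lambda>inp. \<exists>D\<in>pairs n. accepts u v n p s D inp \<and> inp ! reader n D k})"
proof -
  let ?F = "{\<lambda>inp. inp ! i | i. i < 3 * (n + 2)}"
  let ?A = "\<Union>D\<in>pairs n. {accepts u v n p s D}"
  let ?b = "\<lambda>k D inp. accepts u v n p s D inp \<and> inp ! reader n D k"
  have A: "derives m (accepts_cost n * card (pairs n)) ?F ?A"
    using assms by (intro derives_UN finite_pairs derives_accepts)
  have "derives m (card (pairs n) + (card (pairs n) + 1)) (?F \<union> ?A) {\<lambda>inp. \<exists>D\<in>pairs n. ?b k D inp}"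
    if "k < n" for k
  proof (rule derives_chain)
    have "derives m 1 (?F \<union> ?A) {?b k D}" if "D \<in> pairs n" for D
      using reader(1)[OF that \<open>k < n\<close>] that by (intro derives_and) blast+
    then have "derives m (1 * card (pairs n)) (?F \<union> ?A) (\<Union>D\<in>pairs n. {?b k D})"
      by (intro derives_UN finite_pairs)
    then show "derives m (card (pairs n)) (?F \<union> ?A) (\<Union>D\<in>pairs n. {?b k D})" by simp
    show "derives m (card (pairs n) + 1) (?F \<union> ?A \<union> (\<Union>D\<in>pairs n. {?b k D}))
        {\<lambda>inp. \<exists>D\<in>pairs n. ?b k D inp}"
      by (intro derives_ex finite_pairs) blast
  qed
  then have "derives m ((card (pairs n) + (card (pairs n) + 1)) * card {..<n}) (?F \<union> ?A)
      (\<Union>k\<in>{..<n}. {\<lambda>inp. \<exists>D\<in>pairs n. ?b k D inp})"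
    by (intro derives_UN) simp_all
  then show ?thesis using derives_chain[OF A] by (simp only: card_lessThan)
qed

text \<open>The automaton has order \<open>n ^ 6\<close> states for each of \<open>n\<close> bits,
  and the choice of \<open>D\<close> contributes \<open>n ^ 2\<close>.\<close>

lemma decoder_cost_le:
  assumes "1 \<le> n"
  shows "decoder_cost n \<le> 10 ^ 7 * n ^ 9"
proof -
  have pairs: "card (pairs n) \<le> 9 * n ^ 2"
  proof -
    have "card (pairs n) = (n + 2) choose 2" using n_subsets[of "{0<..<n + 3}" 2] by simp
    also have "\<dots> \<le> (n + 2) ^ 2" by (rule binomial_le_pow) simp
    also have "\<dots> \<le> (3 * n) ^ 2" using assms by (intro power_mono) auto
    finally show ?thesis by (simp add: power_mult_distrib)
  qed
  have pow: "1 \<le> n ^ k" for k using assms by simp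
  have mono: "n ^ j \<le> n ^ k" if "j \<le> k" for j k using assms that by (intro power_increasing) auto
  have n: "n ^ 7 = n * n ^ 2 * n ^ 3 * n" "n ^ 9 = n ^ 7 * n ^ 2" "n ^ 3 = n ^ 2 * n"
    by (simp_all add: eval_nat_numeral)
  have "(n + 3) ^ 2 \<le> (4 * n) ^ 2" "(n + 3) ^ 3 \<le> (4 * n) ^ 3"
    using assms by (intro power_mono; simp)+
  then have 23: "(n + 3) ^ 2 + 1 \<le> 17 * n ^ 2" "(n + 3) ^ 3 + 1 \<le> 65 * n ^ 3"
    using pow[of 2] pow[of 3] by (simp_all add: power_mult_distrib)
  have "4 * (2 * (n + 4) * ((n + 3) ^ 2 + 1) * ((n + 3) ^ 3 + 1)) * (n + 1)
      \<le> 4 * (2 * (5 * n) * (17 * n ^ 2) * (65 * n ^ 3)) * (2 * n)"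
    using assms 23 by (intro mult_le_mono order_refl) auto
  also have "\<dots> = 88400 * n ^ 7" by (simp add: n(1))
  finally have T: "4 * (2 * (n + 4) * ((n + 3) ^ 2 + 1) * ((n + 3) ^ 3 + 1)) * (n + 1) \<le> 88400 * n ^ 7" .
  have "2 + ((5 * (3 * (n + 2)) + (3 * (n + 2) + 1)) + (t + 1)) \<le> 100000 * n ^ 7"
    if "t \<le> 88400 * n ^ 7" for t
    using that mono[of 1 7] pow[of 7] by simp
  from this[OF T] have "accepts_cost n \<le> 100000 * n ^ 7" .
  then have "accepts_cost n * card (pairs n) \<le> (100000 * n ^ 7) * (9 * n ^ 2)"
    using pairs by (rule mult_le_mono)
  also have "\<dots> = (100000 * 9) * (n ^ 7 * n ^ 2)" by (simp only: mult_ac)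
  also have "\<dots> = 900000 * n ^ 9" by (simp only: n(2))
  finally have 1: "accepts_cost n * card (pairs n) \<le> 900000 * n ^ 9" .
  have "(card (pairs n) + (card (pairs n) + 1)) * n \<le> (19 * n ^ 2) * n"
    using pairs pow[of 2] by (intro mult_le_mono) auto
  also have "\<dots> = 19 * n ^ 3" by (simp only: n(3) mult.assoc)
  also have "\<dots> \<le> 19 * n ^ 9" using mono[of 3 9] by simp
  finally have 2: "(card (pairs n) + (card (pairs n) + 1)) * n \<le> 19 * n ^ 9" .
  have "900000 * n ^ 9 + 19 * n ^ 9 \<le> 10 ^ 7 * n ^ 9" by simp
  then show ?thesis using add_mono[OF 1 2] by (rule order_trans[rotated])
qed

text \<open>All reads have length 3, so the concatenation can be cut back in one way only.\<close>

lemma concat_received_inj: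
  assumes "D \<in> pairs n" "D' \<in> pairs n" "length z = n + 6" "length z' = n + 6"
    and "concat (nths (read_vector z) (- D)) = concat (nths (read_vector z') (- D'))"
  shows "nths (read_vector z) (- D) = nths (read_vector z') (- D')"
proof -
  have *: "length (nths (read_vector z) (- D)) = n + 2
      \<and> (\<forall>r \<in> set (nths (read_vector z) (- D)). length r = 3)"
    if "D \<in> pairs n" "length z = n + 6" for D z
  proof -
    have "length z - 2 = n + 4" using that by simp
    then have "nths (read_vector z) (- D) = map (\<lambda>i. take 3 (drop i z)) (surviving_reads n D)"
      by (simp only: read_vector_def nths_map surviving_reads_def)
    then show ?thesis using surviving_reads[of D n] that by auto
  qed
  show ?thesis
  proof (rule concat_injective[OF assms(5)], simp add: *[OF assms(1,3)] *[OF assms(2,4)], clarify)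
    fix a b assume "(a, b) \<in> set (zip (nths (read_vector z) (- D)) (nths (read_vector z') (- D')))"
    then show "length a = length b"
      using *[OF assms(1,3)] *[OF assms(2,4)] set_zip_leftD set_zip_rightD by metis
  qed
qed

lemma received_eq:
  assumes "length u = 3" "length v = 3" "length x = n"
  shows "received u v 2 x = (\<lambda>D. nths (read_vector (u @ x @ v)) (- D)) ` pairs n"
proof -
  have "length (read_vector (u @ x @ v)) - 1 = n + 3" using assms by (simp add: read_vector_def)
  then have "received u v 2 x =
      {nths (read_vector (u @ x @ v)) (- D) | D. D \<subseteq> {0<..<n + 3} \<and> card D = 2}"
    by (simp only: received_def deletions_def)
  then show ?thesis by blast
qed

lemma ex_decoder:
  assumes uv: "length u = 3" "length v = 3" and p: "prime p" "n + 6 < p"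
  shows "\<exists>c. decodes u v 2 n (signature_code u v n p s) c \<and> circuit_size c \<le> decoder_cost n"
proof -
  let ?C = "signature_code u v n p s"
  let ?out = "\<lambda>k inp. \<exists>D\<in>pairs n. accepts u v n p s D inp \<and> inp ! reader n D k"
  have outs: "set (map ?out [0..<n]) = (\<Union>k\<in>{..<n}. {?out k})"
    by (simp only: set_map set_upt atLeast0LessThan UNION_singleton_eq_range)
  have d: "derives (3 * (n + 2)) (decoder_cost n) {\<lambda>inp. inp ! i | i. i < 3 * (n + 2)}
      (set (map ?out [0..<n]))"
    unfolding outs using uv by (rule derives_decoder)
  obtain c where c: "circuit_wf (3 * (n + 2)) c" "circuit_size c \<le> decoder_cost n"
    and run: "\<And>inp. length inp = 3 * (n + 2) \<Longrightarrow>
      run_circuit c inp = map (\<lambda>f. f inp) (map ?out [0..<n])"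
    by (rule circuit_of_derives[OF d]) (rule that)
  have "run_circuit c (concat R) = x" if x: "x \<in> ?C" and R: "R \<in> received u v 2 x" for x R
  proof -
    have lenx: "length x = n" using x by (simp add: signature_code_def words_def)
    then obtain D where D: "D \<in> pairs n" "R = nths (read_vector (u @ x @ v)) (- D)"
      using R unfolding received_eq[OF uv lenx] by blast
    have len: "length (concat R) = 3 * (n + 2)"
      using D uv lenx concat_received[of D n "u @ x @ v"] by simp
    have acc: "accepts u v n p s D (concat R)"
      using accepts_iff[OF D(1) uv len] x D(2) by blast
    \<comment> \<open>Several pairs may accept, but unique decodability makes all their guesses
      equal to \<open>x\<close>, so the disjunction over pairs returns the correct bit.\<close>
    have g: "guess n E (concat R) = x" if E: "E \<in> pairs n" and accE: "accepts u v n p s E (concat R)" for E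
    proof -
      obtain y where y: "y \<in> ?C" "concat R = concat (nths (read_vector (u @ y @ v)) (- E))"
        using accepts_iff[OF E uv len] accE by blast
      have leny: "length y = n" using y by (simp add: signature_code_def words_def)
      have "R = nths (read_vector (u @ y @ v)) (- E)"
        using concat_received_inj[OF D(1) E, of "u @ x @ v" "u @ y @ v"] D(2) y(2) uv lenx leny by simp
      then have "R \<in> received u v 2 y"
        using E unfolding received_eq[OF uv leny] by blast
      then have "y = x"
        using uniquely_decodable_signature_code[OF uv p, of s] x y(1) R
        unfolding uniquely_decodable_def by blast
      then show ?thesis using guess_received[OF E uv leny] y(2) by simp
    qed
    have "?out k (concat R) = x ! k" if "k < n" for k
    proof -
      have bit: "concat R ! reader n E k = x ! k"
        if "E \<in> pairs n" "accepts u v n p s E (concat R)" for E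
        using g[OF that] \<open>k < n\<close> by (auto simp: guess_def)
      then show ?thesis using D(1) acc by blast
    qed
    then show ?thesis
      unfolding run[OF len] using lenx by (intro nth_equalityI) auto
  qed
  moreover have "n + 4 - 2 = n + 2" by simp
  ultimately show ?thesis using c unfolding decodes_def by (intro exI[of _ c]) simp
qed


theorem mainTheorem6:
  fixes u v :: "bool list"
  assumes "u \<in> words 3" and "v \<in> words 3"
  shows "\<exists>C :: nat \<Rightarrow> bool list set.
           read_deletion_correcting u v 2 C \<and>
           (\<exists>K :: real. \<forall>n \<ge> 1. redundancy n (C n) \<le> 2 * log 2 (real n) + K)"
proof -
  have uv: "length u = 3" "length v = 3" using assms by (auto simp: words_def)
  have "\<exists>p::nat. prime p \<and> n + 6 < p \<and> p \<le> 4 ^ 6 * (n + 6)" for n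
    using prime_in_linear_range[of "n + 6"] by auto
  then obtain p :: "nat \<Rightarrow> nat"
    where p: "\<And>n. prime (p n)" "\<And>n. n + 6 < p n" "\<And>n. p n \<le> 4 ^ 6 * (n + 6)"
    by metis
  have p0: "0 < p n" for n using p(2)[of n] by simp
  have "\<exists>s. 2 ^ n \<le> card (signature_code u v n (p n) s) * (4 * (p n)\<^sup>2)" for n
    using large_signature_code[OF p0] by metis
  then obtain s where s: "\<And>n. 2 ^ n \<le> card (signature_code u v n (p n) (s n)) * (4 * (p n)\<^sup>2)"
    by metis
  define C where "C n = signature_code u v n (p n) (s n)" for n
  have red: "redundancy n (C n) \<le> 2 * log 2 (real n) + (2 + 2 * log 2 (real (4 ^ 6 * 7)))"
    if "1 \<le> n" for n
  proof (rule redundancy_le[OF _ _ p0 that])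
    show "2 ^ n \<le> card (C n) * (4 * (p n)\<^sup>2)" using s by (simp add: C_def)
    \<comment> \<open>For \<open>n \<ge> 1\<close>, \<open>n + 6 \<le> 7 * n\<close>; this is the
      source of the factor 7 in the constant.\<close>
    have "4 ^ 6 * (n + 6) \<le> 4 ^ 6 * 7 * n" using that by simp
    then show "p n \<le> 4 ^ 6 * 7 * n" using p(3)[of n] by linarith
  qed
  have "C n \<noteq> {}" for n using s[of n] by (auto simp: C_def)
  moreover have "C n \<subseteq> words n" for n by (auto simp: C_def signature_code_def)
  moreover have "uniquely_decodable u v 2 (C n)" for n
    unfolding C_def by (rule uniquely_decodable_signature_code[OF uv p(1,2)])
  moreover have "\<exists>c. decodes u v 2 n (C n) c \<and> circuit_size c \<le> 10 ^ 7 * n ^ 9" if "1 \<le> n" for n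
    using ex_decoder[OF uv p(1,2), of n "s n"] decoder_cost_le[OF that] unfolding C_def
    by (meson order_trans)
  then have "efficiently_decodable u v 2 C"
    unfolding efficiently_decodable_def by blast
  ultimately have "read_deletion_correcting u v 2 C"
    by (simp add: read_deletion_correcting_def)
  then show ?thesis using red by blast
qed

end
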